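(* Let $W$ be a Weyl group with set of reflections $T$ and let $w\in W$ be a parabolic quasi-Coxeter element. Then the Hurwitz action is transitive on the set $\mathrm{Red}_T(w)$ of reduced reflection factorizations of $w$.
   Context: A Weyl group is a group $W=W_\Phi=\langle s_\alpha\mid\alpha\in\Phi\rangle$ for a crystallographic root system $\Phi$ in a Euclidean space (not necessarily irreducible); for a simple system $\Delta \subseteq \Phi$ and $S=\{s_\alpha\mid\alpha\in\Delta\}$, $(W,S)$ is a finite Coxeter system with set of reflections $T=\{s_\alpha\mid\alpha\in\Phi\}$. The reflection length $\ell_T(w)$ is the smallest $m$ such that $w$ is a product of $m$ elements of $T$, and $\mathrm{Red}_T(w)=\{(t_1,\dots,t_m)\in T^m\mid w=t_1\cdots t_m\}$ with $m=\ell_T(w)$. The braid group on $m$ strands $\mathcal{B}_m$, with standard generators $\sigma_1,\dots,\sigma_{m-1}$, acts on $\mathrm{Red}_T(w)$ (Hurwitz action) by $\sigma_i(t_1,\dots,t_m)=(t_1,\dots,t_{i-1},t_it_{i+1}t_i,t_i,t_{i+2},\dots,t_m)$ and $\sigma_i^{-1}(t_1,\dots,t_m)=(t_1,\dots,t_{i-1},t_{i+1},t_{i+1}t_it_{i+1},t_{i+2},\dots,t_m)$. A parabolic subgroup is a subgroup $vW_Iv^{-1}$ with $v\in W$, $I\subseteq S$, $W_I=\langle I\rangle$; it is a Coxeter group with simple reflections $vIv^{-1}$ and rank $|I|$. An element of a Coxeter group of rank $n$ is a quasi-Coxeter element if it admits a reduced reflection factorization with $n$ factors which generate the group. An element $w\in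 W$ is a parabolic quasi-Coxeter element if it is a quasi-Coxeter element of some parabolic subgroup of $W$. *)

theory Defs
  imports "HOL-Analysis.Analysis" "HOL-Algebra.Generated_Groups" "HOL-Algebra.Group_Action"
begin

section \<open>Root systems and Weyl groups\<close>

definition reflection :: "'a::real_inner \<Rightarrow> 'a \<Rightarrow> 'a"
  where "reflection \<alpha> = (\<lambda>x. x - (2 * (x \<bullet> \<alpha>) / (\<alpha> \<bullet> \<alpha>)) *\<^sub>R \<alpha>)"

text \<open>
  The roots are not required to span the ambient space; this makes no difference to the
  associated group and keeps the empty root system (with trivial Weyl group) available.
\<close>

definition crystallographic_root_system :: "'a::euclidean_space set \<Rightarrow> bool"
  where "crystallographic_root_system \<Phi> \<longleftrightarrow>
    finite \<Phi> \<and> 0 \<notin> \<Phi> \<and>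
    (\<forall>\<alpha>\<in>\<Phi>. \<Phi> \<inter> range (\<lambda>c. c *\<^sub>R \<alpha>) = {\<alpha>, - \<alpha>}) \<and>
    (\<forall>\<alpha>\<in>\<Phi>. reflection \<alpha> ` \<Phi> = \<Phi>) \<and>
    (\<forall>\<alpha>\<in>\<Phi>. \<forall>\<beta>\<in>\<Phi>. 2 * (\<beta> \<bullet> \<alpha>) / (\<alpha> \<bullet> \<alpha>) \<in> \<int>)"

definition simple_system :: "'a::euclidean_space set \<Rightarrow> 'a set \<Rightarrow> bool"
  where "simple_system \<Phi> \<Delta> \<longleftrightarrow>
    \<Delta> \<subseteq> \<Phi> \<and> independent \<Delta> \<and> span \<Delta> = span \<Phi> \<and>
    (\<forall>\<alpha>\<in>\<Phi>. \<exists>c. \<alpha> = (\<Sum>\<delta>\<in>\<Delta>. c \<delta> *\<^sub>R \<delta>) \<and>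
      ((\<forall>\<delta>\<in>\<Delta>. 0 \<le> c \<delta>) \<or> (\<forall>\<delta>\<in>\<Delta>. c \<delta> \<le> 0)))"

definition weyl_group :: "'a::euclidean_space set \<Rightarrow> ('a \<Rightarrow> 'a) monoid"
  where "weyl_group \<Phi> =
    (BijGroup UNIV)\<lparr>carrier := generate (BijGroup UNIV) (reflection ` \<Phi>)\<rparr>"


section \<open>Reduced reflection factorizations\<close>

definition word_prod :: "('g, 'b) monoid_scheme \<Rightarrow> 'g list \<Rightarrow> 'g"
  where "word_prod G ts = foldr (\<otimes>\<^bsub>G\<^esub>) ts \<one>\<^bsub>G\<^esub>"

text \<open>Only meaningful for products of elements of \<open>T\<close>; otherwise \<open>LEAST\<close> is unspecified.\<close>

definition reflection_length :: "('g, 'b) monoid_scheme \<Rightarrow> 'g set \<Rightarrow> 'g \<Rightarrow> nat"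
  where "reflection_length G T w =
    (LEAST m. \<exists>ts. set ts \<subseteq> T \<and> length ts = m \<and> word_prod G ts = w)"

definition Red :: "('g, 'b) monoid_scheme \<Rightarrow> 'g set \<Rightarrow> 'g \<Rightarrow> 'g list set"
  where "Red G T w =
    {ts. set ts \<subseteq> T \<and> length ts = reflection_length G T w \<and> word_prod G ts = w}"


section \<open>Parabolic quasi-Coxeter elements\<close>

text \<open>
  A Coxeter system is passed as a group \<open>G\<close> together with its set \<open>S\<close> of simple reflections;
  its rank is \<open>card S\<close> and its reflections are the conjugates of the elements of \<open>S\<close>.
\<close>

definition conj_set :: "('g, 'b) monoid_scheme \<Rightarrow> 'g \<Rightarrow> 'g set \<Rightarrow> 'g set"
  where "conj_set G v X = (\<lambda>x. v \<otimes>\<^bsub>G\<^esub> x \<otimes>\<^bsub>G\<^esub> inv\<^bsub>G\<^esub> v) ` X"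

definition coxeter_reflections :: "('g, 'b) monoid_scheme \<Rightarrow> 'g set \<Rightarrow> 'g set"
  where "coxeter_reflections G S = (\<Union>g\<in>carrier G. conj_set G g S)"

definition quasi_coxeter_element :: "('g, 'b) monoid_scheme \<Rightarrow> 'g set \<Rightarrow> 'g \<Rightarrow> bool"
  where "quasi_coxeter_element G S w \<longleftrightarrow>
    (\<exists>ts \<in> Red G (coxeter_reflections G S) w.
      length ts = card S \<and> generate G (set ts) = carrier G)"

definition parabolic_quasi_coxeter_element ::
    "('g, 'b) monoid_scheme \<Rightarrow> 'g set \<Rightarrow> 'g \<Rightarrow> bool"
  where "parabolic_quasi_coxeter_element G S w \<longleftrightarrow>
    (\<exists>v\<in>carrier G. \<exists>I\<subseteq>S.
      quasi_coxeter_element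
        (G\<lparr>carrier := conj_set G v (generate G I)\<rparr>) (conj_set G v I) w)"


section \<open>Braid groups\<close>

text \<open>
  Strands and tuple positions are counted from 0, so the generators of the braid group on
  \<open>m\<close> strands are indexed by the \<open>i\<close> with \<open>Suc i < m\<close>.  The group is given by its standard
  presentation: words in the generators and their formal inverses, modulo the congruence
  generated by free cancellation and the braid relations.
\<close>

datatype braid_letter = Gen nat | Gen_inv nat

fun letter_index :: "braid_letter \<Rightarrow> nat"
  where
    "letter_index (Gen i) = i"
  | "letter_index (Gen_inv i) = i"

definition braid_words :: "nat \<Rightarrow> braid_letter list set"
  where "braid_words m = lists {a. Suc (letter_index a) < m}"

inductive braid_equiv :: "nat \<Rightarrow> braid_letter list \<Rightarrow> braid_letter list \<Rightarrow> bool"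
  for m :: nat
  where
    refl: "u \<in> braid_words m \<Longrightarrow> braid_equiv m u u"
  | sym: "braid_equiv m u v \<Longrightarrow> braid_equiv m v u"
  | trans: "braid_equiv m u v \<Longrightarrow> braid_equiv m v w \<Longrightarrow> braid_equiv m u w"
  | append: "braid_equiv m u u' \<Longrightarrow> braid_equiv m v v' \<Longrightarrow> braid_equiv m (u @ v) (u' @ v')"
  | right_inv: "Suc i < m \<Longrightarrow> braid_equiv m [Gen i, Gen_inv i] []"
  | left_inv: "Suc i < m \<Longrightarrow> braid_equiv m [Gen_inv i, Gen i] []"
  | far_commute: "Suc i < j \<Longrightarrow> Suc j < m \<Longrightarrow> braid_equiv m [Gen i, Gen j] [Gen j, Gen i]"
  | braid: "Suc (Suc i) < m \<Longrightarrow>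
      braid_equiv m [Gen i, Gen (Suc i), Gen i] [Gen (Suc i), Gen i, Gen (Suc i)]"

definition braid_rel :: "nat \<Rightarrow> (braid_letter list \<times> braid_letter list) set"
  where "braid_rel m = {(u, v). braid_equiv m u v}"

definition braid_group :: "nat \<Rightarrow> braid_letter list set monoid"
  where "braid_group m =
    \<lparr>carrier = braid_words m // braid_rel m,
     mult = (\<lambda>X Y. \<Union>x\<in>X. \<Union>y\<in>Y. braid_rel m `` {x @ y}),
     one = braid_rel m `` {[]}\<rparr>"


section \<open>The Hurwitz action\<close>

fun hurwitz_letter :: "('g, 'b) monoid_scheme \<Rightarrow> braid_letter \<Rightarrow> 'g list \<Rightarrow> 'g list"
  where
    "hurwitz_letter G (Gen i) ts =
      ts[i := ts ! i \<otimes>\<^bsub>G\<^esub> ts ! Suc i \<otimes>\<^bsub>G\<^esub> ts ! i, Suc i := ts ! i]"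
  | "hurwitz_letter G (Gen_inv i) ts =
      ts[i := ts ! Suc i, Suc i := ts ! Suc i \<otimes>\<^bsub>G\<^esub> ts ! i \<otimes>\<^bsub>G\<^esub> ts ! Suc i]"

text \<open>Words act from the left: the last letter is applied first.\<close>

definition hurwitz_word :: "('g, 'b) monoid_scheme \<Rightarrow> braid_letter list \<Rightarrow> 'g list \<Rightarrow> 'g list"
  where "hurwitz_word G u ts = foldr (hurwitz_letter G) u ts"

text \<open>
  The action of a braid, i.e. of a class \<open>X\<close> of words, on a set \<open>E\<close> of tuples.  The choice of
  the representative is immaterial when the tuples in \<open>E\<close> consist of involutions.
\<close>

definition hurwitz_action ::
    "('g, 'b) monoid_scheme \<Rightarrow> 'g list set \<Rightarrow> braid_letter list set \<Rightarrow> 'g list \<Rightarrow> 'g list"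
  where "hurwitz_action G E X = (\<lambda>ts\<in>E. hurwitz_word G (SOME u. u \<in> X) ts)"

end

theory Submission
  imports Defs
begin

text \<open>
  The argument takes place at the level of roots.  Call a linearly independent list
  \<open>a\<^sub>1, \<dots>, a\<^sub>m\<close> of roots a \<^emph>\<open>root basis\<close> if every root of \<open>\<Phi>\<close> in its span is an integer
  combination of the \<open>a\<^sub>i\<close> and its coroot is an integer combination of the coroots of the
  \<open>a\<^sub>i\<close>.

  A parabolic quasi-Coxeter element \<open>w\<close> has a factorization \<open>w = s\<^sub>1 \<dots> s\<^sub>m\<close> by the
  reflections of a root basis.  Indeed, let the reflections \<open>s\<^sub>i\<close> generate the parabolic
  subgroup and let \<open>\<beta>\<close> be one of its simple roots.  There is a weight \<open>y\<close> that pairs to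
  \<open>1\<close> with the coroot of \<open>\<beta>\<close>, so \<open>\<beta> = y - s\<^sub>\<beta> y\<close>.  As \<open>y - g y\<close> lies in the
  lattice of the \<open>a\<^sub>i\<close> for every \<open>g\<close> in the group that the \<open>s\<^sub>i\<close> generate, so does \<open>\<beta>\<close>;
  the same argument in the dual root system handles the coroots
  (\<open>parabolic_quasi_coxeter_root_basis\<close>).  Hurwitz moves turn root bases into root bases,
  and so does deleting the first entry.

  The key fact (\<open>roots_subset_hurwitz_entries\<close>) is that \<^emph>\<open>every\<close> root \<open>\<gamma>\<close> in the span of a
  root basis occurs as an entry of some list in its Hurwitz orbit.  It is proved by induction
  on \<open>m\<close>.  Let \<open>F\<close> be the set of all these entries, suppose that \<open>\<gamma> \<notin> F\<close>, and write
  \<open>\<gamma> = x - w x\<close>.  For \<open>b \<in> F\<close> put \<open>q(b) = (w x, b)\<close>.  Every \<open>b \<in> F\<close> can be moved to the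
  front of its list, and then the coefficient of \<open>b\<close> in \<open>\<gamma>\<close> is \<open>- 2 q(b) / (b, b)\<close>.  So this
  number is an integer; by duality \<open>2 q(b) / (\<gamma>, \<gamma>)\<close> is an integer as well; and neither
  vanishes, because otherwise \<open>\<gamma>\<close> would lie in the span of the remaining entries and hence
  in \<open>F\<close> by induction.  Now \<open>F\<close> is stable under \<open>w\<^sup>-\<^sup>1\<close>, and for \<open>c = w\<^sup>-\<^sup>1 b\<close> we have
  \<open>q(b) - q(c) = (\<gamma>, c)\<close>.  Since \<open>\<gamma> \<noteq> \<plusminus>c\<close>, one of the two Cartan integers of \<open>\<gamma>\<close> and \<open>c\<close>
  has absolute value at most \<open>1\<close>; in the corresponding normalization \<open>q(b)\<close> and \<open>q(c)\<close> are
  nonzero integers at distance at most \<open>1\<close>, so they have the same sign.  Hence \<open>w\<^sup>-\<^sup>1\<close> permutes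
  the finite nonempty set of all \<open>b \<in> F\<close> with \<open>q(b) > 0\<close>, and the sum \<open>z\<close> of this set is
  fixed by \<open>w\<close>.  But \<open>z\<close> also lies in the image of \<open>1 - w\<close>, which is orthogonal to the fixed
  space; so \<open>z = 0\<close>, contradicting \<open>q(z) > 0\<close>.

  Transitivity follows by induction on \<open>m\<close> (\<open>hurwitz_transitive_roots\<close>): if \<open>b\<close> is the first
  root of another reduced factorization of \<open>w\<close>, then \<open>b\<close> lies in the image of \<open>1 - w\<close>, which is
  the span of the root basis.  By the key fact the Hurwitz orbit contains a list that starts
  with \<open>b\<close>, and it remains to compare the two tails.
\<close>


section \<open>Reflections and coroots\<close>

definition coroot :: "'a::real_inner \<Rightarrow> 'a"
  where "coroot a = (2 / (a \<bullet> a)) *\<^sub>R a"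

lemma reflection_eq_coroot: "reflection a x = x - (x \<bullet> coroot a) *\<^sub>R a"
  by (simp add: reflection_def coroot_def)

lemma linear_reflection: "linear (reflection a)"
  by (rule linearI) (simp_all add: reflection_eq_coroot algebra_simps inner_add_left)

lemma reflection_self: "reflection a a = - a"
  by (cases "a = 0") (simp_all add: reflection_def scaleR_2)

lemma reflection_uminus: "reflection (- a) = reflection a"
  by (rule ext) (simp add: reflection_def)

lemma reflection_reflection [simp]: "reflection a (reflection a x) = x"
  by (cases "a = 0") (simp_all add: reflection_def inner_diff_left algebra_simps)

lemma reflection_adjoint: "reflection a x \<bullet> y = x \<bullet> reflection a y"
  by (simp add: reflection_def inner_diff_left inner_diff_right inner_commute)

lemma inner_reflection_reflection [simp]: "reflection a x \<bullet> reflection a y = x \<bullet> y"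
  by (simp add: reflection_adjoint)

text \<open>Instantiated with a product of reflections for \<open>g\<close>, this says that conjugating a reflection
  by a Weyl group element reflects in the transported root.\<close>

lemma reflection_image:
  assumes "linear g" "\<And>x y. g x \<bullet> g y = x \<bullet> y"
  shows "reflection (g b) (g x) = g (reflection b x)"
  using assms by (simp add: reflection_def linear_diff linear_scale)

lemma reflection_reflection_image:
  "reflection (reflection a b) x = reflection a (reflection b (reflection a x))"
  using reflection_image[OF linear_reflection, of a b "reflection a x"] by simp

lemma coroot_image:
  assumes "linear g" "\<And>x y. g x \<bullet> g y = x \<bullet> y"
  shows "coroot (g b) = g (coroot b)"
  using assms by (simp add: coroot_def linear_scale)

lemma coroot_coroot: "coroot (coroot a) = a"
  by (cases "a = 0") (simp_all add: coroot_def)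

lemma reflection_coroot: "reflection (coroot a) = reflection a"
  by (cases "a = 0") (simp_all add: coroot_def reflection_def fun_eq_iff)

lemma coroot_uminus: "coroot (- a) = - coroot a"
  by (simp add: coroot_def)

text \<open>For roots \<open>a\<close> and \<open>b\<close> the coefficient on the right is an integer, so reflections
  preserve the lattice that the coroots span.\<close>

lemma coroot_reflection:
  "coroot (reflection a b) = coroot b - (a \<bullet> coroot b) *\<^sub>R coroot a"
proof -
  have "coroot (reflection a b) = reflection a (coroot b)"
    by (rule coroot_image[OF linear_reflection inner_reflection_reflection])
  also have "\<dots> = reflection (coroot a) (coroot b)"
    by (simp add: reflection_coroot)
  finally show ?thesis
    by (simp add: reflection_eq_coroot coroot_coroot inner_commute)
qed

abbreviation refl_prod :: "'a::real_inner list \<Rightarrow> 'a \<Rightarrow> 'a"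
  where "refl_prod as \<equiv> foldr reflection as"

lemma linear_refl_prod: "linear (refl_prod as)"
proof (induction as)
  case (Cons a as)
  then show ?case
    using linear_compose[OF Cons linear_reflection[of a]] by (simp add: o_def)
qed (simp add: linear_id flip: id_def)

lemma inner_refl_prod [simp]: "refl_prod as x \<bullet> refl_prod as y = x \<bullet> y"
  by (induction as arbitrary: x y) auto

lemma refl_prod_rev [simp]:
  "refl_prod as (refl_prod (rev as) x) = x" "refl_prod (rev as) (refl_prod as x) = x"
  by (induction as arbitrary: x) auto

lemma refl_prod_adjoint: "refl_prod as x \<bullet> y = x \<bullet> refl_prod (rev as) y"
  by (metis inner_refl_prod refl_prod_rev(1))

lemma refl_prod_fixes_orthogonal:
  "(\<And>a. a \<in> set as \<Longrightarrow> y \<bullet> a = 0) \<Longrightarrow> refl_prod as y = y"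
  by (induction as) (auto simp: reflection_def)

text \<open>Together with \<open>refl_prod_moves_onto_span\<close> this identifies the image of \<open>1 - w\<close> with the
  span of the roots of any factorization of \<open>w\<close> into reflections in linearly independent roots.\<close>

lemma refl_prod_moves_in_span: "x - refl_prod as x \<in> span (set as)"
proof (induction as)
  case (Cons a as)
  let ?y = "refl_prod as x"
  have "x - refl_prod (a # as) x = (x - ?y) + (?y \<bullet> coroot a) *\<^sub>R a"
    by (simp add: reflection_eq_coroot)
  moreover have "x - ?y \<in> span (set (a # as))"
    using Cons span_mono[of "set as" "set (a # as)"] by auto
  ultimately show ?case
    by (metis list.set_intros(1) span_add span_base span_scale)
qed (simp add: span_zero)

lemma exists_orthogonal_detecting:
  fixes a :: "'a::euclidean_space"
  assumes "a \<notin> span S"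
  obtains y where "\<And>s. s \<in> S \<Longrightarrow> y \<bullet> s = 0" "y \<bullet> a = 1"
proof -
  obtain p z where p: "p \<in> span S" and z: "\<And>s. s \<in> span S \<Longrightarrow> orthogonal z s" and a: "a = p + z"
    using orthogonal_subspace_decomp_exists[of S a] by metis
  have "z \<noteq> 0"
    using assms p a by auto
  have "z \<bullet> p = 0"
    using z[OF p] by (simp add: orthogonal_def)
  then have za: "z \<bullet> a = z \<bullet> z"
    by (simp add: a inner_add_right)
  show thesis
  proof (rule that[of "(1 / (z \<bullet> z)) *\<^sub>R z"])
    show "(1 / (z \<bullet> z)) *\<^sub>R z \<bullet> s = 0" if "s \<in> S" for s
      using z[OF span_base[OF that]] by (simp add: orthogonal_def)
    show "(1 / (z \<bullet> z)) *\<^sub>R z \<bullet> a = 1"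
      using za \<open>z \<noteq> 0\<close> by simp
  qed
qed

lemma dim_Cons_eq_length:
  fixes as :: "'a::euclidean_space list"
  assumes "dim (set (a # as)) = length (a # as)"
  shows "a \<notin> span (set as)" "dim (set as) = length as"
proof -
  have "dim (set as) \<le> length as"
    using dim_le_card'[of "set as"] card_length[of as] by simp
  then show "a \<notin> span (set as)" "dim (set as) = length as"
    using assms by (auto simp: dim_insert split: if_splits)
qed

text \<open>In the induction step a preimage is first found modulo the head \<open>a\<close>.  Adding a vector that
  is orthogonal to the tail leaves the contribution of the tail unchanged, and such a vector can
  be chosen not orthogonal to \<open>a\<close>, which lets it correct the coefficient of \<open>a\<close>.\<close>

lemma refl_prod_moves_onto_span:
  fixes as :: "'a::euclidean_space list"
  assumes "dim (set as) = length as" "y \<in> span (set as)"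
  obtains x where "x - refl_prod as x = y"
  using assms
proof (induction as arbitrary: y thesis)
  case Nil
  then show ?case by simp
next
  case (Cons a as)
  have a: "a \<notin> span (set as)" and dim: "dim (set as) = length as"
    using dim_Cons_eq_length[OF Cons.prems(2)] by auto
  have a0: "a \<noteq> 0"
    using a span_zero by auto
  obtain k where "y - k *\<^sub>R a \<in> span (set as)"
    using Cons.prems(3) by (auto simp: span_insert)
  then obtain x where x: "x - refl_prod as x = y - k *\<^sub>R a"
    using Cons.IH dim by blast
  obtain z where z: "\<And>s. s \<in> set as \<Longrightarrow> z \<bullet> s = 0" "z \<bullet> a = 1"
    using exists_orthogonal_detecting[OF a] by metis
  have zfix: "refl_prod as z = z"
    using z(1) by (rule refl_prod_fixes_orthogonal)
  \<comment> \<open>chosen such that the coefficient of \<open>a\<close> becomes \<open>k\<close>\<close>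
  define c where "c = (a \<bullet> a) / 2 * (k - refl_prod as x \<bullet> coroot a)"
  have zc: "z \<bullet> coroot a = 2 / (a \<bullet> a)"
    using z(2) by (simp add: coroot_def)
  have lin: "refl_prod as (x + c *\<^sub>R z) = refl_prod as x + c *\<^sub>R z"
    by (simp add: linear_add[OF linear_refl_prod] linear_scale[OF linear_refl_prod] zfix)
  have coef: "(refl_prod as x + c *\<^sub>R z) \<bullet> coroot a = k"
    using a0 by (simp add: inner_add_left zc c_def)
  have "(x + c *\<^sub>R z) - refl_prod (a # as) (x + c *\<^sub>R z) = (x - refl_prod as x) + k *\<^sub>R a"
    by (simp add: lin reflection_eq_coroot[of a] coef)
  also have "\<dots> = y"
    by (simp add: x)
  finally show ?case
    by (rule Cons.prems(1))
qed

text \<open>Both spans are the image of \<open>1 - w\<close>; for \<open>bs\<close> this is forced by the dimension count.\<close>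

lemma span_eq_of_refl_prod_eq:
  fixes as bs :: "'a::euclidean_space list"
  assumes "dim (set as) = length as" "length bs \<le> length as" "refl_prod as = refl_prod bs"
  shows "span (set bs) = span (set as)"
proof -
  have "span (set as) \<subseteq> span (set bs)"
  proof
    fix y assume "y \<in> span (set as)"
    then obtain x where "x - refl_prod as x = y"
      using refl_prod_moves_onto_span[OF assms(1)] by metis
    then show "y \<in> span (set bs)"
      using refl_prod_moves_in_span[of x bs] assms(3) by simp
  qed
  moreover have "dim (span (set bs)) \<le> dim (span (set as))"
    using dim_le_card'[of "set bs"] card_length[of bs] assms(1,2) by simp
  ultimately show ?thesis
    using subspace_dim_equal[of "span (set as)" "span (set bs)"] by simp
qed


section \<open>Root lattices\<close>

interpretation int_mod: module "\<lambda>(n::int) (x::'a::real_vector). of_int n *\<^sub>R x"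
  by standard (simp_all add: scaleR_add_right scaleR_add_left)

abbreviation int_span :: "'a::real_vector set \<Rightarrow> 'a set"
  where "int_span \<equiv> int_mod.span"

lemma int_span_subset_span: "int_span X \<subseteq> span X"
proof
  fix x assume "x \<in> int_span X"
  then show "x \<in> span X"
    by (induction rule: int_mod.span_induct_alt)
      (auto intro: span_zero span_add span_base span_scale)
qed

lemma int_span_scale: "n \<in> \<int> \<Longrightarrow> x \<in> int_span X \<Longrightarrow> n *\<^sub>R x \<in> int_span X"
  by (auto elim!: Ints_cases intro: int_mod.span_scale)

lemma int_span_integral_inner:
  assumes "\<And>x. x \<in> X \<Longrightarrow> y \<bullet> x \<in> \<int>" "z \<in> int_span X"
  shows "y \<bullet> z \<in> \<int>"
  using assms(2)
  by (induction rule: int_mod.span_induct_alt) (auto simp: inner_add_right assms(1))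

lemma int_span_image:
  assumes "linear g" "z \<in> int_span X"
  shows "g z \<in> int_span (g ` X)"
  using assms(2)
  by (induction rule: int_mod.span_induct_alt)
    (auto simp: linear_0[OF assms(1)] linear_add[OF assms(1)] linear_scale[OF assms(1)]
      intro: int_mod.span_zero int_mod.span_add int_mod.span_scale int_mod.span_base)

lemma int_span_trans: "z \<in> int_span X \<Longrightarrow> X \<subseteq> int_span Y \<Longrightarrow> z \<in> int_span Y"
  using int_mod.span_minimal[of X "int_span Y"] by auto

lemma span_coroot: "span (coroot ` X) = span X"
proof -
  have "coroot ` X \<subseteq> span X"
    by (auto simp: coroot_def intro: span_scale span_base)
  moreover have "X \<subseteq> span (coroot ` X)"
  proof
    fix x assume "x \<in> X"
    then have "coroot (coroot x) \<in> span (coroot ` X)"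
      unfolding coroot_def[of "coroot x"] by (intro span_scale span_base) auto
    then show "x \<in> span (coroot ` X)"
      by (simp add: coroot_coroot)
  qed
  ultimately show ?thesis
    by (simp add: span_eq)
qed

locale root_system =
  fixes \<Phi> :: "'a::euclidean_space set"
  assumes crystallographic: "crystallographic_root_system \<Phi>"
begin

lemma finite_roots: "finite \<Phi>"
  and root_nonzero: "\<gamma> \<in> \<Phi> \<Longrightarrow> \<gamma> \<noteq> 0"
  and reflection_root: "\<alpha> \<in> \<Phi> \<Longrightarrow> \<beta> \<in> \<Phi> \<Longrightarrow> reflection \<alpha> \<beta> \<in> \<Phi>"
  using crystallographic unfolding crystallographic_root_system_def by auto

lemma integral_inner_coroot:
  assumes "\<alpha> \<in> \<Phi>" "\<beta> \<in> \<Phi>"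
  shows "\<beta> \<bullet> coroot \<alpha> \<in> \<int>"
  using crystallographic assms unfolding crystallographic_root_system_def
  by (simp add: coroot_def)

lemma parallel_roots:
  assumes "\<alpha> \<in> \<Phi>" "c *\<^sub>R \<alpha> \<in> \<Phi>"
  shows "c *\<^sub>R \<alpha> = \<alpha> \<or> c *\<^sub>R \<alpha> = - \<alpha>"
proof -
  have "\<Phi> \<inter> range (\<lambda>c. c *\<^sub>R \<alpha>) = {\<alpha>, - \<alpha>}"
    using crystallographic assms unfolding crystallographic_root_system_def by auto
  then show ?thesis
    using assms(2) by auto
qed

lemma uminus_root: "\<alpha> \<in> \<Phi> \<Longrightarrow> - \<alpha> \<in> \<Phi>"
  using reflection_root[of \<alpha> \<alpha>] by (simp add: reflection_self)

lemma refl_prod_root: "set as \<subseteq> \<Phi> \<Longrightarrow> \<beta> \<in> \<Phi> \<Longrightarrow> refl_prod as \<beta> \<in> \<Phi>"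
  by (induction as) (auto intro: reflection_root)

text \<open>For non-proportional roots at angle \<open>\<theta>\<close> the product of the two Cartan integers is
  \<open>4 cos\<^sup>2 \<theta> < 4\<close>, so they cannot both have absolute value at least two.\<close>

lemma small_cartan_integer:
  assumes "\<alpha> \<in> \<Phi>" "\<beta> \<in> \<Phi>" "\<alpha> \<noteq> \<beta>" "\<alpha> \<noteq> - \<beta>"
  shows "\<bar>\<alpha> \<bullet> coroot \<beta>\<bar> \<le> 1 \<or> \<bar>\<beta> \<bullet> coroot \<alpha>\<bar> \<le> 1"
proof (rule ccontr)
  assume "\<not> ?thesis"
  then have gt: "\<bar>\<alpha> \<bullet> coroot \<beta>\<bar> > 1" "\<bar>\<beta> \<bullet> coroot \<alpha>\<bar> > 1"
    by auto
  have ge2: "2 \<le> \<bar>r\<bar>" if "r \<in> \<int>" "\<bar>r\<bar> > 1" for r :: real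
    using that by (auto elim!: Ints_cases simp flip: of_int_abs)
  have "2 \<le> \<bar>\<alpha> \<bullet> coroot \<beta>\<bar>" "2 \<le> \<bar>\<beta> \<bullet> coroot \<alpha>\<bar>"
    using gt assms by (auto intro!: ge2 integral_inner_coroot)
  then have "2 * 2 \<le> \<bar>\<alpha> \<bullet> coroot \<beta>\<bar> * \<bar>\<beta> \<bullet> coroot \<alpha>\<bar>"
    by (intro mult_mono) auto
  moreover have pos: "\<alpha> \<bullet> \<alpha> > 0" "\<beta> \<bullet> \<beta> > 0"
    using assms root_nonzero by auto
  ultimately have "(\<alpha> \<bullet> \<alpha>) * (\<beta> \<bullet> \<beta>) \<le> \<bar>\<alpha> \<bullet> \<beta>\<bar> * \<bar>\<alpha> \<bullet> \<beta>\<bar>"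
    by (simp add: coroot_def abs_mult field_simps inner_commute)
  then have "(norm \<alpha> * norm \<beta>)\<^sup>2 \<le> \<bar>\<alpha> \<bullet> \<beta>\<bar>\<^sup>2"
    by (simp add: power2_eq_square power_mult_distrib dot_square_norm algebra_simps)
  then have "norm \<alpha> * norm \<beta> \<le> \<bar>\<alpha> \<bullet> \<beta>\<bar>"
    by (rule power2_le_imp_le) simp
  then have "\<bar>\<alpha> \<bullet> \<beta>\<bar> = norm \<alpha> * norm \<beta>"
    using Cauchy_Schwarz_ineq2[of \<alpha> \<beta>] by simp
  then have "norm \<alpha> *\<^sub>R \<beta> = norm \<beta> *\<^sub>R \<alpha> \<or> norm \<alpha> *\<^sub>R \<beta> = - norm \<beta> *\<^sub>R \<alpha>"
    by (simp add: norm_cauchy_schwarz_abs_eq)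
  then obtain c where "norm \<alpha> *\<^sub>R \<beta> = c *\<^sub>R \<alpha>"
    by blast
  moreover have "\<beta> = (1 / norm \<alpha>) *\<^sub>R (norm \<alpha> *\<^sub>R \<beta>)"
    using assms(1) root_nonzero[of \<alpha>] by simp
  ultimately have "\<beta> = (c / norm \<alpha>) *\<^sub>R \<alpha>"
    by simp
  then have "\<beta> = \<alpha> \<or> \<beta> = - \<alpha>"
    using parallel_roots assms(1,2) by metis
  then show False
    using assms(3,4) by auto
qed

end


section \<open>Hurwitz equivalence of lists of roots\<close>

text \<open>Closing the Hurwitz moves under sign changes of single entries makes the induced relation on
  lists of reflections the usual Hurwitz equivalence: a root and its negative give the same
  reflection.\<close>

inductive hurwitz_equiv :: "'a::euclidean_space list \<Rightarrow> 'a list \<Rightarrow> bool"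
  for us :: "'a list"
  where
    refl: "hurwitz_equiv us us"
  | forward: "hurwitz_equiv us (xs @ a # b # ys) \<Longrightarrow> hurwitz_equiv us (xs @ reflection a b # a # ys)"
  | backward: "hurwitz_equiv us (xs @ a # b # ys) \<Longrightarrow> hurwitz_equiv us (xs @ b # reflection b a # ys)"
  | sign: "hurwitz_equiv us (xs @ a # ys) \<Longrightarrow> hurwitz_equiv us (xs @ (- a) # ys)"

lemma hurwitz_equiv_trans:
  assumes "hurwitz_equiv us vs" "hurwitz_equiv vs ws"
  shows "hurwitz_equiv us ws"
  using assms(2,1) by induction (auto intro: hurwitz_equiv.intros)

lemma hurwitz_equiv_append:
  assumes "hurwitz_equiv us vs"
  shows "hurwitz_equiv (xs @ us @ ys) (xs @ vs @ ys)"
  using assms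
proof induction
  case (forward xs' a b ys')
  then show ?case
    using hurwitz_equiv.forward[of _ "xs @ xs'" a b "ys' @ ys"] by simp
next
  case (backward xs' a b ys')
  then show ?case
    using hurwitz_equiv.backward[of _ "xs @ xs'" a b "ys' @ ys"] by simp
next
  case (sign xs' a ys')
  then show ?case
    using hurwitz_equiv.sign[of _ "xs @ xs'" a "ys' @ ys"] by simp
qed (simp add: hurwitz_equiv.refl)

lemma hurwitz_equiv_Cons:
  "hurwitz_equiv us vs \<Longrightarrow> hurwitz_equiv (a # us) (a # vs)"
  using hurwitz_equiv_append[of us vs "[a]" "[]"] by simp

lemma hurwitz_equiv_length: "hurwitz_equiv us vs \<Longrightarrow> length vs = length us"
  by (induction rule: hurwitz_equiv.induct) auto

lemma hurwitz_equiv_refl_prod: "hurwitz_equiv us vs \<Longrightarrow> refl_prod vs = refl_prod us"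
proof (induction rule: hurwitz_equiv.induct)
  case (forward xs a b ys)
  then show ?case
    by (simp add: fun_eq_iff reflection_reflection_image)
next
  case (backward xs a b ys)
  then show ?case
    by (simp add: fun_eq_iff reflection_reflection_image)
qed (simp_all add: reflection_uminus)

text \<open>The move \<open>(a, b) \<mapsto> (b, s\<^sub>b a)\<close> carries \<open>b\<close> one place to the left without changing it.\<close>

lemma hurwitz_equiv_to_front:
  "\<exists>zs. hurwitz_equiv (xs @ b # ys) (b # zs)"
proof (induction xs arbitrary: ys rule: rev_induct)
  case (snoc a xs)
  have "hurwitz_equiv ((xs @ [a]) @ b # ys) (xs @ b # reflection b a # ys)"
    using hurwitz_equiv.backward[OF hurwitz_equiv.refl, of xs a b ys] by simp
  then show ?case
    using snoc[of "reflection b a # ys"] hurwitz_equiv_trans by blast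
qed (auto intro: hurwitz_equiv.refl)

lemma hurwitz_equiv_to_back:
  "hurwitz_equiv (b # zs) (zs @ [refl_prod (rev zs) b])"
proof (induction zs arbitrary: b)
  case (Cons z zs)
  have "hurwitz_equiv (b # z # zs) (z # reflection z b # zs)"
    using hurwitz_equiv.backward[OF hurwitz_equiv.refl, of "[]" b z zs] by simp
  then show ?case
    using hurwitz_equiv_trans hurwitz_equiv_Cons[OF Cons[of "reflection z b"], of z] by fastforce
qed (simp add: hurwitz_equiv.refl)

text \<open>The set \<open>F\<close> of the proof of the key fact.\<close>

definition hurwitz_entries :: "'a::euclidean_space list \<Rightarrow> 'a set"
  where "hurwitz_entries as = (\<Union>bs\<in>{bs. hurwitz_equiv as bs}. set bs)"

lemma hurwitz_entries_front:
  assumes "b \<in> hurwitz_entries as"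
  obtains zs where "hurwitz_equiv as (b # zs)"
proof -
  obtain bs where bs: "hurwitz_equiv as bs" "b \<in> set bs"
    using assms by (auto simp: hurwitz_entries_def)
  then obtain xs ys where "bs = xs @ b # ys"
    by (meson split_list)
  then show thesis
    using bs hurwitz_equiv_to_front hurwitz_equiv_trans that by metis
qed

lemma hurwitz_entriesI: "hurwitz_equiv as bs \<Longrightarrow> b \<in> set bs \<Longrightarrow> b \<in> hurwitz_entries as"
  by (auto simp: hurwitz_entries_def)

lemma uminus_hurwitz_entries:
  assumes "b \<in> hurwitz_entries as"
  shows "- b \<in> hurwitz_entries as"
proof -
  obtain zs where "hurwitz_equiv as (b # zs)"
    using assms by (rule hurwitz_entries_front)
  then show ?thesis
    using hurwitz_equiv.sign[of as "[]" b zs] by (auto intro: hurwitz_entriesI)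
qed

text \<open>Moving the first entry past all the others conjugates it by the inverse of the product,
  up to sign.\<close>

lemma hurwitz_entries_inverse_prod:
  assumes "b \<in> hurwitz_entries as"
  shows "refl_prod (rev as) b \<in> hurwitz_entries as"
proof -
  obtain zs where zs: "hurwitz_equiv as (b # zs)"
    using assms by (rule hurwitz_entries_front)
  have "hurwitz_equiv as (zs @ [refl_prod (rev zs) b])"
    using zs hurwitz_equiv_to_back hurwitz_equiv_trans by blast
  then have "- refl_prod (rev zs) b \<in> hurwitz_entries as"
    by (intro uminus_hurwitz_entries) (rule hurwitz_entriesI, auto)
  moreover have "refl_prod (rev as) b = refl_prod (rev (b # zs)) b"
    using hurwitz_equiv_refl_prod[OF zs] refl_prod_rev by metis
  moreover have "refl_prod (rev (b # zs)) b = - refl_prod (rev zs) b"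
    by (simp add: reflection_self linear_neg[OF linear_refl_prod])
  ultimately show ?thesis
    by simp
qed


section \<open>Root bases\<close>

text \<open>The equation between dimension and length expresses that the entries are distinct and
  linearly independent, in a form in which only the span and the length enter.  The condition on the
  roots does not imply the one on the coroots: in type \<open>B\<^sub>2\<close> two orthogonal short roots span the
  root lattice, but their coroots span a sublattice of index two.\<close>

definition root_basis :: "'a::euclidean_space set \<Rightarrow> 'a list \<Rightarrow> bool"
  where "root_basis \<Phi> as \<longleftrightarrow>
    set as \<subseteq> \<Phi> \<and> dim (set as) = length as \<and>
    (\<forall>\<gamma>\<in>\<Phi> \<inter> span (set as).
      \<gamma> \<in> int_span (set as) \<and> coroot \<gamma> \<in> int_span (coroot ` set as))"

text \<open>A list that is not longer than a root basis but generates both of its lattices inherits the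
  property.  It is used both for Hurwitz moves and to pass from the simple roots of a parabolic
  subgroup to an arbitrary set of generating reflections.\<close>

lemma root_basis_refine:
  assumes as: "root_basis \<Phi> as"
    and bs: "set bs \<subseteq> \<Phi>" "length bs \<le> length as"
    and gen: "set as \<subseteq> int_span (set bs)" "coroot ` set as \<subseteq> int_span (coroot ` set bs)"
  shows "root_basis \<Phi> bs" "span (set bs) = span (set as)"
proof -
  have sub: "span (set as) \<subseteq> span (set bs)"
    using gen(1) int_span_subset_span by (intro span_minimal) auto
  have dim_as: "dim (set as) = length as"
    using as by (simp add: root_basis_def)
  have "dim (set bs) \<le> length bs"
    using dim_le_card'[of "set bs"] card_length[of bs] by simp
  moreover have "dim (set as) \<le> dim (set bs)"
    using dim_subset[OF sub] by simp
  ultimately have dim: "dim (set bs) = length bs" "dim (set bs) = dim (set as)"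
    using bs(2) dim_as by auto
  then show span: "span (set bs) = span (set as)"
    using subspace_dim_equal[of "span (set as)" "span (set bs)"] sub by simp
  show "root_basis \<Phi> bs"
    unfolding root_basis_def
  proof (intro conjI ballI)
    fix \<gamma> assume "\<gamma> \<in> \<Phi> \<inter> span (set bs)"
    then have "\<gamma> \<in> int_span (set as)" "coroot \<gamma> \<in> int_span (coroot ` set as)"
      using as span by (auto simp: root_basis_def)
    then show "\<gamma> \<in> int_span (set bs)" "coroot \<gamma> \<in> int_span (coroot ` set bs)"
      using gen int_span_trans by blast+
  qed (use bs dim in auto)
qed

text \<open>By linear independence an integer combination of the whole list that lies in the span of the
  tail does not involve the head.\<close>

lemma root_basis_tail:
  assumes "root_basis \<Phi> (b # zs)" "0 \<notin> \<Phi>"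
  shows "root_basis \<Phi> zs"
  unfolding root_basis_def
proof (intro conjI ballI)
  have b: "b \<notin> span (set zs)" and dim: "dim (set zs) = length zs"
    using assms(1) dim_Cons_eq_length[of b zs] by (auto simp: root_basis_def)
  show "set zs \<subseteq> \<Phi>" "dim (set zs) = length zs"
    using assms(1) dim by (auto simp: root_basis_def)
  fix \<gamma> assume \<gamma>: "\<gamma> \<in> \<Phi> \<inter> span (set zs)"
  have cancel: "x \<in> int_span X"
    if x: "x \<in> int_span (insert c X)" "x \<in> span X" "c \<notin> span X" for x c :: 'a and X
  proof -
    obtain k :: int where k: "x - of_int k *\<^sub>R c \<in> int_span X"
      using x(1) unfolding int_mod.span_breakdown_eq by (elim exE)
    then have "x - (x - of_int k *\<^sub>R c) \<in> span X"
      by (rule span_diff[OF x(2) subsetD[OF int_span_subset_span]])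
    then have "of_int k *\<^sub>R c \<in> span X"
      by simp
    then have "k = 0"
      using x(3) span_scale[of "of_int k *\<^sub>R c" X "1 / of_int k"] by (cases "k = 0") auto
    then show ?thesis
      using k by simp
  qed
  have mem: "\<gamma> \<in> \<Phi> \<inter> span (set (b # zs))"
    using \<gamma> span_mono[of "set zs" "set (b # zs)"] by auto
  show "\<gamma> \<in> int_span (set zs)"
    using mem assms(1) \<gamma> b by (intro cancel[of \<gamma> b "set zs"]) (auto simp: root_basis_def)
  have "coroot \<gamma> \<in> span (coroot ` set zs)"
    using \<gamma> unfolding span_coroot coroot_def[of \<gamma>] by (intro span_scale) auto
  moreover have "coroot b \<notin> span (coroot ` set zs)"
  proof
    assume "coroot b \<in> span (coroot ` set zs)"
    then have "coroot (coroot b) \<in> span (set zs)"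
      unfolding coroot_def[of "coroot b"] by (intro span_scale) (simp add: span_coroot)
    then show False
      using b by (simp add: coroot_coroot)
  qed
  ultimately show "coroot \<gamma> \<in> int_span (coroot ` set zs)"
    using mem assms(1)
    by (intro cancel[of "coroot \<gamma>" "coroot b" "coroot ` set zs"]) (auto simp: root_basis_def)
qed

context root_system
begin

text \<open>Up to order and sign, a Hurwitz move adds an integer multiple of one entry to another, and
  likewise for the coroots, so both lattices are unchanged.\<close>

lemma root_basis_hurwitz_equiv:
  assumes "hurwitz_equiv us vs" "root_basis \<Phi> us"
  shows "root_basis \<Phi> vs"
  using assms
proof (induction rule: hurwitz_equiv.induct)
  case (forward xs a b ys)
  let ?vs = "xs @ reflection a b # a # ys"
  have basis: "root_basis \<Phi> (xs @ a # b # ys)" and roots: "set (xs @ a # b # ys) \<subseteq> \<Phi>"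
    using forward by (auto simp: root_basis_def)
  have "reflection a b + (b \<bullet> coroot a) *\<^sub>R a \<in> int_span (set ?vs)"
    using roots by (intro int_mod.span_add int_span_scale integral_inner_coroot int_mod.span_base) auto
  then have b: "b \<in> int_span (set ?vs)"
    by (simp add: reflection_eq_coroot)
  have "coroot (reflection a b) + (a \<bullet> coroot b) *\<^sub>R coroot a \<in> int_span (coroot ` set ?vs)"
    using roots by (intro int_mod.span_add int_span_scale integral_inner_coroot int_mod.span_base) auto
  then have cb: "coroot b \<in> int_span (coroot ` set ?vs)"
    by (simp add: coroot_reflection)
  show ?case
    using b cb roots
    by (intro root_basis_refine(1)[OF basis]) (auto intro: int_mod.span_base reflection_root)
next
  case (backward xs a b ys)
  let ?vs = "xs @ b # reflection b a # ys"
  have basis: "root_basis \<Phi> (xs @ a # b # ys)" and roots: "set (xs @ a # b # ys) \<subseteq> \<Phi>"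
    using backward by (auto simp: root_basis_def)
  have "reflection b a + (a \<bullet> coroot b) *\<^sub>R b \<in> int_span (set ?vs)"
    using roots by (intro int_mod.span_add int_span_scale integral_inner_coroot int_mod.span_base) auto
  then have a: "a \<in> int_span (set ?vs)"
    by (simp add: reflection_eq_coroot)
  have "coroot (reflection b a) + (b \<bullet> coroot a) *\<^sub>R coroot b \<in> int_span (coroot ` set ?vs)"
    using roots by (intro int_mod.span_add int_span_scale integral_inner_coroot int_mod.span_base) auto
  then have ca: "coroot a \<in> int_span (coroot ` set ?vs)"
    by (simp add: coroot_reflection)
  show ?case
    using a ca roots
    by (intro root_basis_refine(1)[OF basis]) (auto intro: int_mod.span_base reflection_root)
next
  case (sign xs a ys)
  let ?vs = "xs @ (- a) # ys"
  have basis: "root_basis \<Phi> (xs @ a # ys)" and roots: "set (xs @ a # ys) \<subseteq> \<Phi>"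
    using sign by (auto simp: root_basis_def)
  have "- (- a) \<in> int_span (set ?vs)" "- coroot (- a) \<in> int_span (coroot ` set ?vs)"
    by (intro int_mod.span_neg int_mod.span_base; force)+
  then show ?case
    using roots
    by (intro root_basis_refine(1)[OF basis])
      (auto intro: int_mod.span_base uminus_root simp: coroot_uminus)
qed


section \<open>Every root of the span occurs in the Hurwitz orbit\<close>

text \<open>By \<open>refl_prod_moves_in_span\<close> for the tail, the coefficient of \<open>b\<close> in the expansion of \<open>\<gamma>\<close> is
  \<open>- 2 p / (b, b)\<close>, and the coefficient of the coroot of \<open>b\<close> in the expansion of the coroot of
  \<open>\<gamma>\<close> is \<open>- 2 p / (\<gamma>, \<gamma>)\<close>.\<close>

lemma leading_coefficient:
  assumes basis: "root_basis \<Phi> (b # zs)"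
    and \<gamma>: "\<gamma> \<in> \<Phi>" "x - refl_prod (b # zs) x = \<gamma>"
  defines "p \<equiv> refl_prod (b # zs) x \<bullet> b"
  shows "p * (2 / (b \<bullet> b)) \<in> \<int>" "p * (2 / (\<gamma> \<bullet> \<gamma>)) \<in> \<int>" "p = 0 \<Longrightarrow> \<gamma> \<in> span (set zs)"
proof -
  define w' where "w' = refl_prod zs x"
  define k where "k = - (p * (2 / (b \<bullet> b)))"
  have b: "b \<notin> span (set zs)"
    using basis dim_Cons_eq_length[of b zs] by (auto simp: root_basis_def)
  have b0: "b \<noteq> 0"
    using b span_zero by auto
  have p: "p = - (w' \<bullet> b)"
    unfolding p_def w'_def by (simp add: reflection_adjoint reflection_self)
  have k': "w' \<bullet> coroot b = k"
    by (simp add: k_def p coroot_def)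
  have dec: "\<gamma> = (x - w') + k *\<^sub>R b"
    using \<gamma>(2) by (auto simp: reflection_eq_coroot[of b] k' simp flip: w'_def)
  have tail: "x - w' \<in> span (set zs)"
    unfolding w'_def by (rule refl_prod_moves_in_span)
  have uniq: "c = k" if "\<gamma> - c *\<^sub>R b \<in> span (set zs)" for c
  proof (rule ccontr)
    assume "c \<noteq> k"
    have "(x - w') - (\<gamma> - c *\<^sub>R b) \<in> span (set zs)"
      using tail that by (rule span_diff)
    then have "(c - k) *\<^sub>R b \<in> span (set zs)"
      by (simp add: dec algebra_simps)
    then have "(1 / (c - k)) *\<^sub>R ((c - k) *\<^sub>R b) \<in> span (set zs)"
      by (rule span_scale)
    then show False
      using b \<open>c \<noteq> k\<close> by simp
  qed
  have "\<gamma> \<in> span (set (b # zs))"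
    using refl_prod_moves_in_span[of x "b # zs"] \<gamma>(2) by simp
  then have ints: "\<gamma> \<in> int_span (insert b (set zs))"
      "coroot \<gamma> \<in> int_span (insert (coroot b) (coroot ` set zs))"
    using basis \<gamma>(1) by (auto simp: root_basis_def)
  obtain m :: int where "\<gamma> - of_int m *\<^sub>R b \<in> int_span (set zs)"
    using ints(1) unfolding int_mod.span_breakdown_eq by (elim exE)
  then have "k = of_int m"
    using uniq int_span_subset_span[of "set zs"] by auto
  then have "- k \<in> \<int>"
    by simp
  then show "p * (2 / (b \<bullet> b)) \<in> \<int>"
    by (simp add: k_def)
  obtain n :: int where "coroot \<gamma> - of_int n *\<^sub>R coroot b \<in> int_span (coroot ` set zs)"
    using ints(2) unfolding int_mod.span_breakdown_eq by (elim exE)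
  then have "coroot \<gamma> - of_int n *\<^sub>R coroot b \<in> span (set zs)"
    using int_span_subset_span[of "coroot ` set zs"] unfolding span_coroot by (rule subsetD[rotated])
  then have "((\<gamma> \<bullet> \<gamma>) / 2) *\<^sub>R (coroot \<gamma> - of_int n *\<^sub>R coroot b) \<in> span (set zs)"
    by (rule span_scale)
  moreover have "((\<gamma> \<bullet> \<gamma>) / 2) *\<^sub>R (coroot \<gamma> - of_int n *\<^sub>R coroot b) =
      \<gamma> - (of_int n * (\<gamma> \<bullet> \<gamma>) / (b \<bullet> b)) *\<^sub>R b"
    using root_nonzero[OF \<gamma>(1)] by (simp add: coroot_def algebra_simps)
  ultimately have "of_int n * (\<gamma> \<bullet> \<gamma>) / (b \<bullet> b) = k"
    by (intro uniq) simp
  then have "p * (2 / (\<gamma> \<bullet> \<gamma>)) = of_int (- n)"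
    using root_nonzero[OF \<gamma>(1)] b0 by (simp add: k_def field_simps)
  then show "p * (2 / (\<gamma> \<bullet> \<gamma>)) \<in> \<int>"
    by simp
  show "\<gamma> \<in> span (set zs)" if "p = 0"
    using dec tail that by (simp add: k_def)
qed

lemma same_sign_of_small_difference:
  fixes m n :: real
  assumes "m \<in> \<int>" "n \<in> \<int>" "m \<noteq> 0" "n \<noteq> 0" "\<bar>m - n\<bar> \<le> 1" "m > 0"
  shows "n > 0"
proof -
  have "\<bar>m\<bar> \<ge> 1" "\<bar>n\<bar> \<ge> 1"
    using assms(1-4) Ints_nonzero_abs_ge1 by auto
  then show ?thesis
    using assms(5,6) by linarith
qed

text \<open>The roots in the orbit that pair positively with \<open>w x\<close> are permuted by \<open>w\<^sup>-\<^sup>1\<close> unless \<open>\<gamma>\<close>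
  occurs in the orbit, while the sum of a \<open>w\<^sup>-\<^sup>1\<close>-invariant set of vectors in the image of
  \<open>1 - w\<close> vanishes.\<close>

theorem roots_subset_hurwitz_entries:
  assumes "root_basis \<Phi> as"
  shows "\<Phi> \<inter> span (set as) \<subseteq> hurwitz_entries as"
  using assms
proof (induction "length as" arbitrary: as)
  case 0
  then show ?case
    using root_nonzero by auto
next
  case (Suc m)
  show ?case
  proof (rule subsetI, rule ccontr)
    fix \<gamma> assume "\<gamma> \<in> \<Phi> \<inter> span (set as)" and \<gamma>F: "\<gamma> \<notin> hurwitz_entries as"
    then have \<gamma>: "\<gamma> \<in> \<Phi>" "\<gamma> \<in> span (set as)"
      by auto
    let ?F = "hurwitz_entries as" and ?w = "refl_prod as" and ?v = "refl_prod (rev as)"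
    have indep: "dim (set as) = length as"
      using Suc.prems by (simp add: root_basis_def)
    obtain x where x: "x - ?w x = \<gamma>"
      using refl_prod_moves_onto_span[OF indep \<gamma>(2)] by metis
    define q where "q b = ?w x \<bullet> b" for b
    have F: "b \<in> \<Phi>" "b \<in> span (set as)" "q b * (2 / (b \<bullet> b)) \<in> \<int>" "q b * (2 / (\<gamma> \<bullet> \<gamma>)) \<in> \<int>"
        "q b \<noteq> 0" if b: "b \<in> ?F" for b
    proof -
      obtain zs where zs: "hurwitz_equiv as (b # zs)"
        using b by (rule hurwitz_entries_front)
      have basis: "root_basis \<Phi> (b # zs)"
        using root_basis_hurwitz_equiv[OF zs Suc.prems] .
      have w: "refl_prod (b # zs) = ?w"
        using hurwitz_equiv_refl_prod[OF zs] .
      have len: "length (b # zs) = length as"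
        using hurwitz_equiv_length[OF zs] .
      show "b \<in> \<Phi>"
        using basis by (simp add: root_basis_def)
      show "b \<in> span (set as)"
        using span_eq_of_refl_prod_eq[of as "b # zs"] indep len w span_base[of b "set (b # zs)"]
        by simp
      note coef = leading_coefficient[OF basis \<gamma>(1), unfolded w, OF x]
      show "q b * (2 / (b \<bullet> b)) \<in> \<int>" "q b * (2 / (\<gamma> \<bullet> \<gamma>)) \<in> \<int>"
        using coef(1,2) by (simp_all add: q_def)
      show "q b \<noteq> 0"
      proof
        assume "q b = 0"
        then have "\<gamma> \<in> span (set zs)"
          using coef(3) by (simp add: q_def)
        moreover have "root_basis \<Phi> zs"
          using root_basis_tail[OF basis] root_nonzero by blast
        moreover have "length zs = m"
          using len Suc.hyps(2) by simp
        ultimately have "\<gamma> \<in> hurwitz_entries zs"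
          using Suc.hyps(1) \<gamma>(1) by blast
        then obtain cs where "hurwitz_equiv zs cs" "\<gamma> \<in> set cs"
          by (auto simp: hurwitz_entries_def)
        then have "hurwitz_equiv as (b # cs)" "\<gamma> \<in> set (b # cs)"
          using hurwitz_equiv_trans[OF zs hurwitz_equiv_Cons] by auto
        then show False
          using \<gamma>F hurwitz_entriesI by blast
      qed
    qed
    have vF: "?v b \<in> ?F" if "b \<in> ?F" for b
      using that by (rule hurwitz_entries_inverse_prod)
    have q_pos: "q (?v b) > 0" if b: "b \<in> ?F" "q b > 0" for b
    proof -
      let ?c = "?v b"
      have c: "?c \<in> ?F"
        using vF b(1) .
      have "q b = x \<bullet> ?c"
        by (simp add: q_def refl_prod_adjoint)
      then have diff: "q b - q ?c = \<gamma> \<bullet> ?c"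
        by (simp add: q_def inner_diff_left flip: x)
      have "?c \<bullet> ?c = b \<bullet> b"
        by simp
      then have int: "q b * (2 / (?c \<bullet> ?c)) \<in> \<int>"
        using F(3)[OF b(1)] by simp
      have norms: "?c \<bullet> ?c > 0" "\<gamma> \<bullet> \<gamma> > 0"
        using root_nonzero[OF F(1)[OF c]] root_nonzero[OF \<gamma>(1)] inner_gt_zero_iff by blast+
      have "\<gamma> \<noteq> ?c" "\<gamma> \<noteq> - ?c"
        using c \<gamma>F uminus_hurwitz_entries by auto
      then consider "\<bar>\<gamma> \<bullet> coroot ?c\<bar> \<le> 1" | "\<bar>?c \<bullet> coroot \<gamma>\<bar> \<le> 1"
        using small_cartan_integer[OF \<gamma>(1) F(1)[OF c]] by blast
      then show "q ?c > 0"
      proof cases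
        case 1
        have "q ?c * (2 / (?c \<bullet> ?c)) > 0"
        proof (rule same_sign_of_small_difference[OF int F(3)[OF c]])
          have "q b * (2 / (?c \<bullet> ?c)) - q ?c * (2 / (?c \<bullet> ?c)) = \<gamma> \<bullet> coroot ?c"
            by (simp only: coroot_def inner_scaleR_right mult.commute flip: diff left_diff_distrib)
          then show "\<bar>q b * (2 / (?c \<bullet> ?c)) - q ?c * (2 / (?c \<bullet> ?c))\<bar> \<le> 1"
            using 1 by simp
        qed (use norms F(5)[OF c] b in auto)
        then show ?thesis
          by (rule zero_less_mult_pos2[OF _ divide_pos_pos[OF zero_less_numeral norms(1)]])
      next
        case 2
        have "q ?c * (2 / (\<gamma> \<bullet> \<gamma>)) > 0"
        proof (rule same_sign_of_small_difference[OF F(4)[OF b(1)] F(4)[OF c]])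
          have "q b * (2 / (\<gamma> \<bullet> \<gamma>)) - q ?c * (2 / (\<gamma> \<bullet> \<gamma>)) = ?c \<bullet> coroot \<gamma>"
            by (simp only: coroot_def inner_scaleR_right mult.commute inner_commute[of ?c]
                flip: diff left_diff_distrib)
          then show "\<bar>q b * (2 / (\<gamma> \<bullet> \<gamma>)) - q ?c * (2 / (\<gamma> \<bullet> \<gamma>))\<bar> \<le> 1"
            using 2 by simp
        qed (use norms F(5)[OF c] b in auto)
        then show ?thesis
          by (rule zero_less_mult_pos2[OF _ divide_pos_pos[OF zero_less_numeral norms(2)]])
      qed
    qed
    \<comment> \<open>the sum of \<open>P\<close> is fixed by \<open>w\<close> and orthogonal to the fixed space\<close>
    define P where "P = {b \<in> ?F. q b > 0}"
    define z where "z = \<Sum>P"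
    have "finite P"
      using finite_subset[OF _ finite_roots, of P] F(1) by (auto simp: P_def)
    have "inj_on ?v P"
      using refl_prod_rev(1) by (intro inj_on_inverseI[of _ ?w]) auto
    moreover have "?v ` P \<subseteq> P"
      using vF q_pos by (auto simp: P_def)
    ultimately have "bij_betw ?v P P"
      using endo_inj_surj[OF \<open>finite P\<close>] by (simp add: bij_betw_def)
    then have vz: "?v z = z"
      unfolding z_def linear_sum[OF linear_refl_prod]
      by (rule sum.reindex_bij_betw)
    have "z \<in> span (set as)"
      unfolding z_def using F(2) by (intro span_sum) (auto simp: P_def)
    then obtain y where y: "y - ?w y = z"
      using refl_prod_moves_onto_span[OF indep] by metis
    have "z \<bullet> z = (y - ?w y) \<bullet> z"
      by (simp only: y)
    also have "\<dots> = 0"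
      by (simp add: inner_diff_left refl_prod_adjoint vz)
    finally have "z \<bullet> z = 0" .
    then have "q z = 0"
      by (simp add: q_def)
    moreover have "q z = (\<Sum>b\<in>P. q b)"
      by (simp add: q_def z_def inner_sum_right)
    moreover have "P \<noteq> {}"
    proof -
      obtain a where "a \<in> set as"
        using Suc.hyps(2) by (cases as) auto
      then have a: "a \<in> ?F" "- a \<in> ?F"
        using hurwitz_entriesI[OF hurwitz_equiv.refl] uminus_hurwitz_entries by auto
      moreover have "q (- a) = - q a"
        by (simp add: q_def)
      ultimately show ?thesis
        using F(5)[OF a(1)] unfolding P_def by (cases "q a > 0") auto
    qed
    then have "(\<Sum>b\<in>P. q b) > 0"
      using \<open>finite P\<close> by (intro sum_pos) (auto simp: P_def)
    ultimately show False
      by simp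
  qed
qed

text \<open>By the key fact the orbit of \<open>as\<close> contains a list that starts with the head of \<open>bs\<close>;
  cancelling the common first reflection leaves two tails with the same product.  The lists
  agree only after passing to reflections because roots are determined up to sign.\<close>

theorem hurwitz_transitive_roots:
  assumes "root_basis \<Phi> as" "set bs \<subseteq> \<Phi>" "length bs = length as" "refl_prod bs = refl_prod as"
  shows "\<exists>cs. hurwitz_equiv as cs \<and> map reflection cs = map reflection bs"
  using assms
proof (induction bs arbitrary: as)
  case Nil
  then show ?case
    using hurwitz_equiv.refl by auto
next
  case (Cons b bs)
  have "span (set (b # bs)) = span (set as)"
    using Cons.prems(1,3) span_eq_of_refl_prod_eq[OF _ _ Cons.prems(4)[symmetric]]
    by (simp add: root_basis_def)
  then have "b \<in> \<Phi> \<inter> span (set as)"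
    using Cons.prems(2) span_base[of b "set (b # bs)"] by auto
  then have "b \<in> hurwitz_entries as"
    using roots_subset_hurwitz_entries[OF Cons.prems(1)] by blast
  then obtain zs where zs: "hurwitz_equiv as (b # zs)"
    by (rule hurwitz_entries_front)
  have "root_basis \<Phi> zs"
    using root_basis_tail[OF root_basis_hurwitz_equiv[OF zs Cons.prems(1)]] root_nonzero by blast
  moreover have "length bs = length zs"
    using hurwitz_equiv_length[OF zs] Cons.prems(3) by simp
  moreover have "refl_prod bs = refl_prod zs"
  proof
    fix x
    have "refl_prod (b # bs) x = refl_prod (b # zs) x"
      by (simp only: hurwitz_equiv_refl_prod[OF zs] Cons.prems(4))
    then have "reflection b (refl_prod bs x) = reflection b (refl_prod zs x)"
      by simp
    then show "refl_prod bs x = refl_prod zs x"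
      by (metis reflection_reflection)
  qed
  ultimately obtain cs where "hurwitz_equiv zs cs" "map reflection cs = map reflection bs"
    using Cons.IH Cons.prems(2) by auto
  then have "hurwitz_equiv as (b # cs)" "map reflection (b # cs) = map reflection (b # bs)"
    using hurwitz_equiv_trans[OF zs hurwitz_equiv_Cons] by auto
  then show ?case
    by blast
qed

end


section \<open>Simple roots\<close>

lemma exists_dual_vectors:
  fixes \<Delta> :: "'a::euclidean_space set"
  assumes "independent \<Delta>"
  shows "\<exists>d. \<forall>\<delta>\<in>\<Delta>. \<forall>\<delta>'\<in>\<Delta>. d \<delta> \<bullet> \<delta>' = (if \<delta>' = \<delta> then 1 else 0)"
proof -
  have "\<exists>y. \<forall>\<delta>'\<in>\<Delta>. y \<bullet> \<delta>' = (if \<delta>' = \<delta> then 1 else 0)" if "\<delta> \<in> \<Delta>" for \<delta>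
  proof -
    have "\<delta> \<notin> span (\<Delta> - {\<delta>})"
      using assms that by (auto simp: dependent_def)
    then obtain y where "\<And>s. s \<in> \<Delta> - {\<delta>} \<Longrightarrow> y \<bullet> s = 0" "y \<bullet> \<delta> = 1"
      using exists_orthogonal_detecting by metis
    then show ?thesis
      by (intro exI[of _ y]) auto
  qed
  then show ?thesis
    by (intro bchoice) auto
qed

lemma dual_coefficient:
  fixes \<Delta> :: "'a::euclidean_space set"
  assumes "finite J" "J \<subseteq> \<Delta>" "\<delta> \<in> \<Delta>" "\<gamma> = (\<Sum>\<epsilon>\<in>J. u \<epsilon> *\<^sub>R \<epsilon>)"
    and d: "\<And>\<delta> \<delta>'. \<delta> \<in> \<Delta> \<Longrightarrow> \<delta>' \<in> \<Delta> \<Longrightarrow> d \<delta> \<bullet> \<delta>' = (if \<delta>' = \<delta> then 1 else 0)"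
  shows "d \<delta> \<bullet> \<gamma> = (if \<delta> \<in> J then u \<delta> else 0)"
proof -
  have "d \<delta> \<bullet> \<gamma> = (\<Sum>\<epsilon>\<in>J. u \<epsilon> * (d \<delta> \<bullet> \<epsilon>))"
    by (simp add: assms(4) inner_sum_right)
  also have "\<dots> = (\<Sum>\<epsilon>\<in>J. if \<epsilon> = \<delta> then u \<delta> else 0)"
    using assms(2,3) d by (intro sum.cong) auto
  finally show ?thesis
    using assms(1) by simp
qed

lemma dual_expansion:
  fixes \<Delta> :: "'a::euclidean_space set"
  assumes "finite J" "J \<subseteq> \<Delta>" "\<gamma> \<in> span J"
    and d: "\<And>\<delta> \<delta>'. \<delta> \<in> \<Delta> \<Longrightarrow> \<delta>' \<in> \<Delta> \<Longrightarrow> d \<delta> \<bullet> \<delta>' = (if \<delta>' = \<delta> then 1 else 0)"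
  shows "\<gamma> = (\<Sum>\<delta>\<in>J. (d \<delta> \<bullet> \<gamma>) *\<^sub>R \<delta>)"
proof -
  obtain u where u: "\<gamma> = (\<Sum>\<delta>\<in>J. u \<delta> *\<^sub>R \<delta>)"
    using assms(1,3) by (auto simp: span_finite)
  have "d \<delta> \<bullet> \<gamma> = u \<delta>" if "\<delta> \<in> J" for \<delta>
    using dual_coefficient[OF assms(1,2) subsetD[OF assms(2) that] u d] that by simp
  then show ?thesis
    by (subst u, intro sum.cong) auto
qed

context root_system
begin

text \<open>Induction on the height of a positive root \<open>\<beta>\<close>, measured by \<open>\<rho>\<close>: some \<open>\<delta> \<in> J\<close> has positive
  inner product with \<open>\<beta>\<close>, and unless \<open>\<beta> = \<delta>\<close> the reflection in \<open>\<delta>\<close> gives a lower root that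
  is still positive and differs from \<open>\<beta>\<close> by an integer multiple of \<open>\<delta>\<close>.  The coroots follow
  along.\<close>

lemma simple_roots_generate_lattices:
  assumes simple: "simple_system \<Phi> \<Delta>" and J: "J \<subseteq> \<Delta>" and \<gamma>: "\<gamma> \<in> \<Phi>" "\<gamma> \<in> span J"
  shows "\<gamma> \<in> int_span J \<and> coroot \<gamma> \<in> int_span (coroot ` J)"
proof -
  have \<Delta>: "\<Delta> \<subseteq> \<Phi>" "independent \<Delta>"
    using simple by (simp_all add: simple_system_def)
  have fin: "finite \<Delta>" "finite J"
    using finite_subset[OF \<Delta>(1) finite_roots] finite_subset[OF J] by simp_all
  obtain d where "\<forall>\<delta>\<in>\<Delta>. \<forall>\<delta>'\<in>\<Delta>. d \<delta> \<bullet> \<delta>' = (if \<delta>' = \<delta> then 1 else 0)"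
    using exists_dual_vectors[OF \<Delta>(2)] by (elim exE)
  note d = this[rule_format]
  have expansion: "\<forall>\<alpha>\<in>\<Phi>. \<exists>c. \<alpha> = (\<Sum>\<delta>\<in>\<Delta>. c \<delta> *\<^sub>R \<delta>) \<and>
      ((\<forall>\<delta>\<in>\<Delta>. 0 \<le> c \<delta>) \<or> (\<forall>\<delta>\<in>\<Delta>. c \<delta> \<le> 0))"
    using simple unfolding simple_system_def by (elim conjE)
  have coherent: "(\<forall>\<delta>\<in>\<Delta>. 0 \<le> d \<delta> \<bullet> \<beta>) \<or> (\<forall>\<delta>\<in>\<Delta>. d \<delta> \<bullet> \<beta> \<le> 0)" if "\<beta> \<in> \<Phi>" for \<beta>
  proof -
    obtain c where c: "\<beta> = (\<Sum>\<delta>\<in>\<Delta>. c \<delta> *\<^sub>R \<delta>)" "(\<forall>\<delta>\<in>\<Delta>. 0 \<le> c \<delta>) \<or> (\<forall>\<delta>\<in>\<Delta>. c \<delta> \<le> 0)"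
      using bspec[OF expansion \<open>\<beta> \<in> \<Phi>\<close>] by (elim exE conjE)
    have "d \<delta> \<bullet> \<beta> = c \<delta>" if "\<delta> \<in> \<Delta>" for \<delta>
      using dual_coefficient[OF fin(1) order_refl that c(1) d] that by simp
    then show ?thesis
      using c(2) by auto
  qed
  define \<rho> where "\<rho> = (\<Sum>\<delta>\<in>\<Delta>. d \<delta>)"
  have \<rho>: "\<rho> \<bullet> \<delta> = 1" if "\<delta> \<in> \<Delta>" for \<delta>
  proof -
    have "\<rho> \<bullet> \<delta> = (\<Sum>\<delta>'\<in>\<Delta>. if \<delta>' = \<delta> then 1 else 0)"
      unfolding \<rho>_def inner_sum_left using that d by (intro sum.cong) auto
    then show ?thesis
      using that fin(1) by simp
  qed
  have pos: "\<beta> \<in> int_span J \<and> coroot \<beta> \<in> int_span (coroot ` J)"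
    if "\<beta> \<in> \<Phi>" "\<beta> \<in> span J" "\<And>\<delta>. \<delta> \<in> \<Delta> \<Longrightarrow> 0 \<le> d \<delta> \<bullet> \<beta>" for \<beta>
    using that
  proof (induction "card {\<alpha> \<in> \<Phi>. \<rho> \<bullet> \<alpha> < \<rho> \<bullet> \<beta>}" arbitrary: \<beta> rule: less_induct)
    case less
    have "\<beta> \<bullet> \<beta> = \<beta> \<bullet> (\<Sum>\<delta>\<in>J. (d \<delta> \<bullet> \<beta>) *\<^sub>R \<delta>)"
      using dual_expansion[OF fin(2) J less.prems(2) d] by simp
    also have "\<dots> = (\<Sum>\<delta>\<in>J. (d \<delta> \<bullet> \<beta>) * (\<beta> \<bullet> \<delta>))"
      by (simp add: inner_sum_right)
    finally have "(\<Sum>\<delta>\<in>J. (d \<delta> \<bullet> \<beta>) * (\<beta> \<bullet> \<delta>)) > 0"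
      using root_nonzero[OF less.prems(1)] by (metis inner_gt_zero_iff)
    then obtain \<delta> where \<delta>: "\<delta> \<in> J" "(d \<delta> \<bullet> \<beta>) * (\<beta> \<bullet> \<delta>) > 0"
      by (metis (no_types, lifting) not_le sum_nonpos)
    then have \<delta>': "\<delta> \<in> \<Delta>" "\<delta> \<in> \<Phi>" "d \<delta> \<bullet> \<beta> > 0" "\<beta> \<bullet> \<delta> > 0"
      using J \<Delta> less.prems(3)[of \<delta>] by (auto simp: zero_less_mult_iff)
    show ?case
    proof (cases "\<beta> = \<delta>")
      case True
      then show ?thesis
        using \<delta>(1) by (auto intro: int_mod.span_base)
    next
      case False
      let ?\<beta> = "reflection \<delta> \<beta>"
      have root: "?\<beta> \<in> \<Phi>"
        using reflection_root \<delta>'(2) less.prems(1) .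
      have span: "?\<beta> \<in> span J"
        using less.prems(2) \<delta>(1)
        by (auto simp: reflection_eq_coroot intro: span_diff span_scale span_base)
      \<comment> \<open>a positive coefficient that the reflection does not change keeps the image positive\<close>
      have "\<exists>\<epsilon>\<in>\<Delta> - {\<delta>}. d \<epsilon> \<bullet> \<beta> > 0"
      proof (rule ccontr)
        assume "\<not> ?thesis"
        then have zero: "d \<epsilon> \<bullet> \<beta> = 0" if "\<epsilon> \<in> J - {\<delta>}" for \<epsilon>
          using that J less.prems(3)[of \<epsilon>] by force
        have "\<beta> = (\<Sum>\<epsilon>\<in>J. (d \<epsilon> \<bullet> \<beta>) *\<^sub>R \<epsilon>)"
          using dual_expansion[OF fin(2) J less.prems(2) d] .
        also have "\<dots> = (d \<delta> \<bullet> \<beta>) *\<^sub>R \<delta>"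
          using zero \<delta>(1) fin(2) by (subst sum.remove[of _ \<delta>]) auto
        finally have "\<beta> = (d \<delta> \<bullet> \<beta>) *\<^sub>R \<delta>" .
        then have "\<beta> = - \<delta>"
          using parallel_roots[of \<delta> "d \<delta> \<bullet> \<beta>"] \<delta>'(2) less.prems(1) False by auto
        then show False
          using \<delta>'(4) inner_ge_zero[of \<delta>] by simp
      qed
      then obtain \<epsilon> where \<epsilon>: "\<epsilon> \<in> \<Delta>" "\<epsilon> \<noteq> \<delta>" "d \<epsilon> \<bullet> \<beta> > 0"
        by auto
      then have "d \<epsilon> \<bullet> ?\<beta> > 0"
        using d \<delta>'(1) by (simp add: reflection_eq_coroot inner_diff_right)
      then have nonneg: "0 \<le> d \<kappa> \<bullet> ?\<beta>" if "\<kappa> \<in> \<Delta>" for \<kappa>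
        using coherent[OF root] \<epsilon>(1) that by force
      have "\<beta> \<bullet> coroot \<delta> > 0"
        using \<delta>'(2,4) root_nonzero by (simp add: coroot_def)
      then have lower: "\<rho> \<bullet> ?\<beta> < \<rho> \<bullet> \<beta>"
        using \<rho>[OF \<delta>'(1)] by (simp add: reflection_eq_coroot inner_diff_right)
      have "card {\<alpha> \<in> \<Phi>. \<rho> \<bullet> \<alpha> < \<rho> \<bullet> ?\<beta>} < card {\<alpha> \<in> \<Phi>. \<rho> \<bullet> \<alpha> < \<rho> \<bullet> \<beta>}"
        using lower root finite_roots by (intro psubset_card_mono) auto
      then have IH: "?\<beta> \<in> int_span J" "coroot ?\<beta> \<in> int_span (coroot ` J)"
        using less.hyps root span nonneg by auto
      have "?\<beta> - (?\<beta> \<bullet> coroot \<delta>) *\<^sub>R \<delta> \<in> int_span J"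
        using \<delta>(1) integral_inner_coroot[OF \<delta>'(2) root]
        by (intro int_mod.span_diff[OF IH(1)] int_span_scale int_mod.span_base)
      then have "\<beta> \<in> int_span J"
        by (simp flip: reflection_eq_coroot)
      moreover have "coroot ?\<beta> - (\<delta> \<bullet> coroot ?\<beta>) *\<^sub>R coroot \<delta> \<in> int_span (coroot ` J)"
        using \<delta>(1) integral_inner_coroot[OF root \<delta>'(2)]
        by (intro int_mod.span_diff[OF IH(2)] int_span_scale int_mod.span_base imageI)
      then have "coroot \<beta> \<in> int_span (coroot ` J)"
        by (simp flip: coroot_reflection)
      ultimately show ?thesis ..
    qed
  qed
  show ?thesis
  proof (cases "\<forall>\<delta>\<in>\<Delta>. 0 \<le> d \<delta> \<bullet> \<gamma>")
    case True
    then show ?thesis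
      using pos \<gamma> by blast
  next
    case False
    then have "\<forall>\<delta>\<in>\<Delta>. 0 \<le> d \<delta> \<bullet> - \<gamma>"
      using coherent[OF \<gamma>(1)] by auto
    then have "- \<gamma> \<in> int_span J" "coroot (- \<gamma>) \<in> int_span (coroot ` J)"
      using pos[of "- \<gamma>"] \<gamma> uminus_root span_neg by auto
    then show ?thesis
      using int_mod.span_neg[of "- \<gamma>" J] int_mod.span_neg[of "coroot (- \<gamma>)" "coroot ` J"]
      by (simp add: coroot_uminus)
  qed
qed

end


section \<open>Generators of a parabolic subgroup\<close>

lemma refl_prod_map_coroot: "refl_prod (map coroot bs) = refl_prod bs"
  by (induction bs) (simp_all add: reflection_coroot)

text \<open>The set \<open>R\<close> is left open so that the lemma applies both to the roots and to the coroots;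
  \<open>y\<close> is a weight of \<open>R\<close>.  Each reflection of the product moves a weight by an integer multiple
  of its root.\<close>

lemma weight_moves_in_lattice:
  assumes closed: "\<And>a b. a \<in> R \<Longrightarrow> b \<in> R \<Longrightarrow> reflection a b \<in> R"
    and weight: "\<And>b. b \<in> R \<Longrightarrow> y \<bullet> coroot b \<in> \<int>"
    and "set bs \<subseteq> R"
  shows "y - refl_prod bs y \<in> int_span (set bs)"
  using assms(3)
proof (induction bs)
  case (Cons a bs)
  have closed': "refl_prod cs b \<in> R" if "set cs \<subseteq> R" "b \<in> R" for cs b
    using that by (induction cs) (auto intro: closed)
  have "refl_prod bs y \<bullet> coroot a = y \<bullet> coroot (refl_prod (rev bs) a)"
    by (simp add: refl_prod_adjoint coroot_image[OF linear_refl_prod])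
  then have int: "refl_prod bs y \<bullet> coroot a \<in> \<int>"
    using weight closed'[of "rev bs" a] Cons.prems by simp
  have mem: "y - refl_prod bs y \<in> int_span (set (a # bs))"
    using Cons int_mod.span_mono[of "set bs" "set (a # bs)"] by auto
  have "(y - refl_prod bs y) + (refl_prod bs y \<bullet> coroot a) *\<^sub>R a \<in> int_span (set (a # bs))"
    by (intro int_mod.span_add[OF mem] int_span_scale[OF int] int_mod.span_base) simp
  then show ?case
    by (simp add: reflection_eq_coroot[of a] algebra_simps)
qed (simp add: int_mod.span_zero)

text \<open>If the weight \<open>y\<close> pairs to \<open>1\<close> with the coroot of \<open>\<beta>\<close>, then \<open>\<beta> = y - s\<^sub>\<beta> y\<close>.\<close>

lemma root_in_lattice_of_factorization:
  assumes "\<And>a b. a \<in> R \<Longrightarrow> b \<in> R \<Longrightarrow> reflection a b \<in> R"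
    and "\<And>b. b \<in> R \<Longrightarrow> y \<bullet> coroot b \<in> \<int>"
    and "set bs \<subseteq> R" "reflection \<beta> = refl_prod bs" "y \<bullet> coroot \<beta> = 1"
  shows "\<beta> \<in> int_span (set bs)"
  using weight_moves_in_lattice[OF assms(1-3)] assms(5)
  by (simp add: reflection_eq_coroot flip: assms(4))

context root_system
begin

text \<open>The weight needed for \<open>root_in_lattice_of_factorization\<close> is a fundamental weight,
  transported by the Weyl group element; for the coroot it is a fundamental coweight.\<close>

lemma transported_simple_root_in_lattices:
  assumes simple: "simple_system \<Phi> \<Delta>" and \<delta>: "\<delta> \<in> \<Delta>" and us: "set us \<subseteq> \<Phi>"
    and bs: "set bs \<subseteq> \<Phi>" "reflection (refl_prod us \<delta>) = refl_prod bs"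
  shows "refl_prod us \<delta> \<in> int_span (set bs)"
    "coroot (refl_prod us \<delta>) \<in> int_span (coroot ` set bs)"
proof -
  let ?v = "refl_prod us" and ?v' = "refl_prod (rev us)"
  have \<Delta>: "\<Delta> \<subseteq> \<Phi>" "independent \<Delta>" "\<Phi> \<subseteq> span \<Delta>"
    using simple span_superset[of \<Phi>] by (simp_all add: simple_system_def)
  obtain d where "\<forall>\<delta>\<in>\<Delta>. \<forall>\<delta>'\<in>\<Delta>. d \<delta> \<bullet> \<delta>' = (if \<delta>' = \<delta> then 1 else 0)"
    using exists_dual_vectors[OF \<Delta>(2)] by (elim exE)
  note d = this[rule_format]
  have pull: "?v' b \<in> \<Phi>" if "b \<in> \<Phi>" for b
    using us that by (intro refl_prod_root) auto
  have lattices: "b \<in> int_span \<Delta>" "coroot b \<in> int_span (coroot ` \<Delta>)" if "b \<in> \<Phi>" for b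
    using simple_roots_generate_lattices[OF simple order_refl] that \<Delta>(3) by auto
  have move: "?v x \<bullet> b = x \<bullet> ?v' b" "?v x \<bullet> coroot b = x \<bullet> coroot (?v' b)" for x b
    by (simp_all add: refl_prod_adjoint coroot_image[OF linear_refl_prod])
  have \<delta>0: "\<delta> \<noteq> 0"
    using \<delta> \<Delta>(1) root_nonzero by blast
  \<comment> \<open>the fundamental weight of \<open>\<delta>\<close>; the coweight is \<open>d \<delta>\<close> itself\<close>
  define x where "x = ((\<delta> \<bullet> \<delta>) / 2) *\<^sub>R d \<delta>"
  have x: "x \<bullet> coroot \<epsilon> = (if \<epsilon> = \<delta> then 1 else 0)" if "\<epsilon> \<in> \<Delta>" for \<epsilon>
    using d[OF \<delta> that] \<delta>0 by (simp add: x_def coroot_def)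
  show "?v \<delta> \<in> int_span (set bs)"
  proof (rule root_in_lattice_of_factorization[of \<Phi>])
    show "?v x \<bullet> coroot b \<in> \<int>" if "b \<in> \<Phi>" for b
      unfolding move(2) using x
      by (intro int_span_integral_inner[OF _ lattices(2)[OF pull[OF that]]]) auto
    show "?v x \<bullet> coroot (?v \<delta>) = 1"
      using x[OF \<delta>] by (simp add: move(2))
  qed (use bs reflection_root in auto)
  have "coroot (?v \<delta>) \<in> int_span (set (map coroot bs))"
  proof (rule root_in_lattice_of_factorization[of "coroot ` \<Phi>"])
    show "reflection a b \<in> coroot ` \<Phi>" if "a \<in> coroot ` \<Phi>" "b \<in> coroot ` \<Phi>" for a b
      using that reflection_root
      by (auto simp: reflection_coroot simp flip: coroot_image[OF linear_reflection])
    show "?v (d \<delta>) \<bullet> coroot b \<in> \<int>" if "b \<in> coroot ` \<Phi>" for b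
    proof -
      obtain c where c: "c \<in> \<Phi>" "b = coroot c"
        using \<open>b \<in> coroot ` \<Phi>\<close> by auto
      have "d \<delta> \<bullet> ?v' c \<in> \<int>"
        using d[OF \<delta>] by (intro int_span_integral_inner[OF _ lattices(1)[OF pull[OF c(1)]]]) auto
      then show ?thesis
        by (simp add: c(2) coroot_coroot move(1))
    qed
    show "?v (d \<delta>) \<bullet> coroot (coroot (?v \<delta>)) = 1"
      using d[OF \<delta> \<delta>] by (simp add: coroot_coroot)
    show "reflection (coroot (?v \<delta>)) = refl_prod (map coroot bs)"
      by (simp add: bs(2) reflection_coroot refl_prod_map_coroot)
  qed (use bs in auto)
  then show "coroot (?v \<delta>) \<in> int_span (coroot ` set bs)"
    by simp
qed

text \<open>The transported simple roots form a root basis, and they lie in the lattices of \<open>as\<close>.\<close>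

lemma root_basis_of_parabolic_generators:
  assumes simple: "simple_system \<Phi> \<Delta>" and J: "J \<subseteq> \<Delta>" and us: "set us \<subseteq> \<Phi>"
    and as: "set as \<subseteq> \<Phi>" "length as \<le> card J"
    and gen: "\<And>\<delta>. \<delta> \<in> J \<Longrightarrow> \<exists>bs. set bs \<subseteq> set as \<and> reflection (refl_prod us \<delta>) = refl_prod bs"
  shows "root_basis \<Phi> as"
proof -
  let ?v = "refl_prod us" and ?v' = "refl_prod (rev us)"
  have \<Delta>: "\<Delta> \<subseteq> \<Phi>" "independent \<Delta>"
    using simple by (simp_all add: simple_system_def)
  have finJ: "finite J"
    using finite_subset[OF J finite_subset[OF \<Delta>(1) finite_roots]] .
  have inj: "inj ?v"
    by (rule inj_on_inverseI[of _ ?v']) simp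
  obtain js where js: "set js = ?v ` J" "distinct js"
    using finite_distinct_list[of "?v ` J"] finJ by auto
  have len: "length js = card J"
    using distinct_card[OF js(2)] card_image[OF inj_on_subset[OF inj subset_UNIV]] by (simp add: js(1))
  have "independent (?v ` J)"
    using linear_independent_injective_image[OF linear_refl_prod, of J us]
      independent_mono[OF \<Delta>(2) J] inj_on_subset[OF inj subset_UNIV] by blast
  then have dim: "dim (set js) = length js"
    using dim_eq_card_independent len js distinct_card by metis
  have basis: "root_basis \<Phi> js"
    unfolding root_basis_def
  proof (intro conjI ballI)
    show "set js \<subseteq> \<Phi>"
      using js(1) J \<Delta>(1) refl_prod_root[OF us] by auto
    fix \<gamma> assume "\<gamma> \<in> \<Phi> \<inter> span (set js)"
    then have \<gamma>: "\<gamma> \<in> \<Phi>" "\<gamma> \<in> ?v ` span J"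
      by (auto simp: js(1) linear_span_image[OF linear_refl_prod])
    then obtain \<gamma>' where \<gamma>': "\<gamma>' \<in> span J" "\<gamma> = ?v \<gamma>'"
      by auto
    have "\<gamma>' \<in> \<Phi>"
      using refl_prod_root[of "rev us" \<gamma>] us \<gamma>(1) \<gamma>'(2) by simp
    then have *: "\<gamma>' \<in> int_span J" "coroot \<gamma>' \<in> int_span (coroot ` J)"
      using simple_roots_generate_lattices[OF simple J] \<gamma>'(1) by auto
    show "\<gamma> \<in> int_span (set js)"
      using int_span_image[OF linear_refl_prod *(1)] by (simp add: js(1) \<gamma>'(2))
    have "coroot ` ?v ` J = ?v ` coroot ` J"
      by (simp add: image_image coroot_image[OF linear_refl_prod])
    then show "coroot \<gamma> \<in> int_span (coroot ` set js)"
      using int_span_image[OF linear_refl_prod *(2), of us]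
      by (simp add: js(1) \<gamma>'(2) coroot_image[OF linear_refl_prod])
  qed (rule dim)
  have "?v \<delta> \<in> int_span (set as) \<and> coroot (?v \<delta>) \<in> int_span (coroot ` set as)" if "\<delta> \<in> J" for \<delta>
  proof -
    obtain bs where bs: "set bs \<subseteq> set as" "reflection (?v \<delta>) = refl_prod bs"
      using gen[OF \<open>\<delta> \<in> J\<close>] by auto
    have "?v \<delta> \<in> int_span (set bs)" "coroot (?v \<delta>) \<in> int_span (coroot ` set bs)"
      using transported_simple_root_in_lattices[OF simple _ us _ bs(2)] bs(1) as(1) J that by auto
    then show ?thesis
      using int_mod.span_mono[OF bs(1)] int_mod.span_mono[OF image_mono[OF bs(1)], of coroot] by blast
  qed
  then show ?thesis
    using as len by (intro root_basis_refine(1)[OF basis]) (auto simp: js(1))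
qed

end


section \<open>The braid group and its action on tuples of involutions\<close>

lemma braid_equiv_words:
  "braid_equiv m u v \<Longrightarrow> u \<in> braid_words m \<and> v \<in> braid_words m"
  by (induction rule: braid_equiv.induct) (auto simp: braid_words_def)

lemma braid_words_append: "u @ v \<in> braid_words m \<longleftrightarrow> u \<in> braid_words m \<and> v \<in> braid_words m"
  by (auto simp: braid_words_def)

lemma braid_words_Cons:
  "a # u \<in> braid_words m \<longleftrightarrow> Suc (letter_index a) < m \<and> u \<in> braid_words m"
  by (auto simp: braid_words_def)

lemma equiv_braid_rel: "equiv (braid_words m) (braid_rel m)"
  by (rule equivI)
    (auto simp: braid_rel_def refl_on_def sym_def trans_def
      dest: braid_equiv_words intro: braid_equiv.intros)

abbreviation braid_class :: "nat \<Rightarrow> braid_letter list \<Rightarrow> braid_letter list set"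
  where "braid_class m u \<equiv> braid_rel m `` {u}"

lemma braid_class_eq_iff:
  "u \<in> braid_words m \<Longrightarrow> v \<in> braid_words m \<Longrightarrow> braid_class m u = braid_class m v \<longleftrightarrow> braid_equiv m u v"
  using eq_equiv_class_iff[OF equiv_braid_rel] by (simp add: braid_rel_def)

lemma carrier_braid_group: "carrier (braid_group m) = braid_class m ` braid_words m"
  by (auto simp: braid_group_def quotient_def)

lemma one_braid_group: "\<one>\<^bsub>braid_group m\<^esub> = braid_class m []"
  by (simp add: braid_group_def)

lemma mult_braid_group:
  assumes "u \<in> braid_words m" "v \<in> braid_words m"
  shows "braid_class m u \<otimes>\<^bsub>braid_group m\<^esub> braid_class m v = braid_class m (u @ v)"
proof -
  have "braid_class m (x @ y) = braid_class m (u @ v)"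
    if "x \<in> braid_class m u" "y \<in> braid_class m v" for x y
  proof -
    have "braid_equiv m u x" "braid_equiv m v y"
      using that by (auto simp: braid_rel_def)
    then have "braid_equiv m (u @ v) (x @ y)"
      by (rule braid_equiv.append)
    then show ?thesis
      using braid_class_eq_iff braid_equiv_words by blast
  qed
  then have "(\<Union>x\<in>braid_class m u. \<Union>y\<in>braid_class m v. braid_class m (x @ y))
      = (\<Union>x\<in>braid_class m u. \<Union>y\<in>braid_class m v. braid_class m (u @ v))"
    by (intro SUP_cong HOL.refl)
  moreover have "braid_class m u \<noteq> {}" "braid_class m v \<noteq> {}"
    using assms braid_equiv.refl by (auto simp: braid_rel_def)
  ultimately show ?thesis
    by (simp add: braid_group_def)
qed

fun inverse_letter :: "braid_letter \<Rightarrow> braid_letter"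
  where
    "inverse_letter (Gen i) = Gen_inv i"
  | "inverse_letter (Gen_inv i) = Gen i"

definition inverse_word :: "braid_letter list \<Rightarrow> braid_letter list"
  where "inverse_word u = rev (map inverse_letter u)"

lemma letter_index_inverse [simp]: "letter_index (inverse_letter a) = letter_index a"
  by (cases a) auto

lemma inverse_inverse_letter [simp]: "inverse_letter (inverse_letter a) = a"
  by (cases a) auto

lemma inverse_word_in_braid_words: "u \<in> braid_words m \<Longrightarrow> inverse_word u \<in> braid_words m"
  by (auto simp: braid_words_def inverse_word_def)

lemma inverse_inverse_word [simp]: "inverse_word (inverse_word u) = u"
  by (simp add: inverse_word_def rev_map o_def)

lemma inverse_word_left:
  "u \<in> braid_words m \<Longrightarrow> braid_equiv m (inverse_word u @ u) []"
proof (induction u)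
  case Nil
  then show ?case
    by (simp add: inverse_word_def braid_equiv.refl)
next
  case (Cons a u)
  then have a: "Suc (letter_index a) < m" and u: "u \<in> braid_words m"
    by (auto simp: braid_words_Cons)
  have "braid_equiv m [inverse_letter a, a] []"
    using a by (cases a) (auto intro: braid_equiv.intros)
  then have "braid_equiv m (inverse_word u @ [inverse_letter a, a] @ u) (inverse_word u @ [] @ u)"
    using u inverse_word_in_braid_words by (intro braid_equiv.append braid_equiv.refl) auto
  then show ?case
    using Cons.IH[OF u] braid_equiv.trans by (fastforce simp: inverse_word_def)
qed

lemma group_braid_group: "group (braid_group m)"
proof (rule groupI)
  have nil: "[] \<in> braid_words m"
    by (simp add: braid_words_def)
  show "\<one>\<^bsub>braid_group m\<^esub> \<in> carrier (braid_group m)"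
    using nil by (simp add: one_braid_group carrier_braid_group)
  fix x assume "x \<in> carrier (braid_group m)"
  then obtain u where u: "u \<in> braid_words m" "x = braid_class m u"
    by (auto simp: carrier_braid_group)
  show "\<one>\<^bsub>braid_group m\<^esub> \<otimes>\<^bsub>braid_group m\<^esub> x = x"
    using nil u by (simp add: one_braid_group mult_braid_group)
  have "braid_class m (inverse_word u) \<otimes>\<^bsub>braid_group m\<^esub> x = \<one>\<^bsub>braid_group m\<^esub>"
    using inverse_word_left[OF u(1)] inverse_word_in_braid_words[OF u(1)] u nil
    by (simp add: mult_braid_group one_braid_group braid_class_eq_iff braid_words_append)
  then show "\<exists>y\<in>carrier (braid_group m). y \<otimes>\<^bsub>braid_group m\<^esub> x = \<one>\<^bsub>braid_group m\<^esub>"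
    using inverse_word_in_braid_words[OF u(1)] by (auto simp: carrier_braid_group)
  fix y assume "y \<in> carrier (braid_group m)"
  then obtain v where v: "v \<in> braid_words m" "y = braid_class m v"
    by (auto simp: carrier_braid_group)
  show "x \<otimes>\<^bsub>braid_group m\<^esub> y \<in> carrier (braid_group m)"
    using u v by (simp add: mult_braid_group carrier_braid_group braid_words_append)
  fix z assume "z \<in> carrier (braid_group m)"
  then obtain t where "t \<in> braid_words m" "z = braid_class m t"
    by (auto simp: carrier_braid_group)
  then show "x \<otimes>\<^bsub>braid_group m\<^esub> y \<otimes>\<^bsub>braid_group m\<^esub> z = x \<otimes>\<^bsub>braid_group m\<^esub> (y \<otimes>\<^bsub>braid_group m\<^esub> z)"
    using u v by (simp add: mult_braid_group braid_words_append)
qed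

lemma hurwitz_letter_Gen:
  assumes "length xs = i"
  shows "hurwitz_letter G (Gen i) (xs @ a # b # ys) = xs @ (a \<otimes>\<^bsub>G\<^esub> b \<otimes>\<^bsub>G\<^esub> a) # a # ys"
  using assms by (auto simp: nth_append list_update_append)

lemma hurwitz_letter_Gen_inv:
  assumes "length xs = i"
  shows "hurwitz_letter G (Gen_inv i) (xs @ a # b # ys) = xs @ b # (b \<otimes>\<^bsub>G\<^esub> a \<otimes>\<^bsub>G\<^esub> b) # ys"
  using assms by (auto simp: nth_append list_update_append)

lemma split_at_adjacent:
  assumes "Suc i < length ts"
  obtains xs a b ys where "ts = xs @ a # b # ys" "length xs = i"
proof
  show "ts = take i ts @ ts ! i # ts ! Suc i # drop (Suc (Suc i)) ts"
    using assms by (simp add: Cons_nth_drop_Suc)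
qed (use assms in auto)

lemma hurwitz_word_append: "hurwitz_word G (u @ v) ts = hurwitz_word G u (hurwitz_word G v ts)"
  by (simp add: hurwitz_word_def)

text \<open>For tuples of involutions the Hurwitz moves satisfy the relations of the braid group, so any
  set of such tuples that the moves preserve carries an action.\<close>

locale hurwitz_stable = group G for G (structure) +
  fixes m :: nat and E :: "'a list set"
  assumes tuples: "ts \<in> E \<Longrightarrow> length ts = m \<and> set ts \<subseteq> carrier G"
    and involutions: "ts \<in> E \<Longrightarrow> t \<in> set ts \<Longrightarrow> t \<otimes> t = \<one>"
    and stable: "ts \<in> E \<Longrightarrow> Suc (letter_index a) < m \<Longrightarrow> hurwitz_letter G a ts \<in> E"
begin

lemma hurwitz_word_stable: "u \<in> braid_words m \<Longrightarrow> ts \<in> E \<Longrightarrow> hurwitz_word G u ts \<in> E"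
  by (induction u) (auto simp: hurwitz_word_def braid_words_Cons intro: stable)

lemma cancel_involution:
  assumes "a \<in> carrier G" "a \<otimes> a = \<one>" "x \<in> carrier G"
  shows "a \<otimes> (a \<otimes> x) = x"
  using assms by (simp flip: m_assoc)

lemma hurwitz_word_cong:
  assumes "braid_equiv m u v" "ts \<in> E"
  shows "hurwitz_word G u ts = hurwitz_word G v ts"
  using assms
proof (induction arbitrary: ts rule: braid_equiv.induct)
  case (append u u' v v')
  then show ?case
    using hurwitz_word_stable braid_equiv_words by (metis hurwitz_word_append)
next
  case (right_inv i)
  then obtain xs a b ys where ts: "ts = xs @ a # b # ys" "length xs = i"
    using split_at_adjacent[of i ts] tuples by metis
  have "a \<in> carrier G" "b \<in> carrier G" "b \<otimes> b = \<one>"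
    using tuples[OF right_inv(2)] involutions[OF right_inv(2)] by (auto simp: ts)
  then show ?case
    using ts(2) by (simp add: hurwitz_word_def ts(1) hurwitz_letter_Gen hurwitz_letter_Gen_inv
        m_assoc cancel_involution del: hurwitz_letter.simps)
next
  case (left_inv i)
  then obtain xs a b ys where ts: "ts = xs @ a # b # ys" "length xs = i"
    using split_at_adjacent[of i ts] tuples by metis
  have "a \<in> carrier G" "b \<in> carrier G" "a \<otimes> a = \<one>"
    using tuples[OF left_inv(2)] involutions[OF left_inv(2)] by (auto simp: ts)
  then show ?case
    using ts(2) by (simp add: hurwitz_word_def ts(1) hurwitz_letter_Gen hurwitz_letter_Gen_inv
        m_assoc cancel_involution del: hurwitz_letter.simps)
next
  case (far_commute i j)
  then obtain zs c d ws where ts: "ts = zs @ c # d # ws" "length zs = j"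
    using split_at_adjacent[of j ts] tuples by metis
  then obtain xs a b ys where zs: "zs = xs @ a # b # ys" "length xs = i"
    using split_at_adjacent[of i zs] far_commute(1) by metis
  have j: "\<And>p q. length (xs @ p # q # ys) = j"
    using ts(2) by (simp add: zs(1))
  have "hurwitz_word G [Gen i, Gen j] ts
      = hurwitz_letter G (Gen i) ((xs @ a # b # ys) @ (c \<otimes> d \<otimes> c) # c # ws)"
    using hurwitz_letter_Gen[OF j, of G a b c d ws] by (simp add: hurwitz_word_def ts zs)
  also have "\<dots> = xs @ (a \<otimes> b \<otimes> a) # a # (ys @ (c \<otimes> d \<otimes> c) # c # ws)"
    using hurwitz_letter_Gen[OF zs(2), of G a b "ys @ (c \<otimes> d \<otimes> c) # c # ws"] by simp
  also have "\<dots> = hurwitz_letter G (Gen j) ((xs @ (a \<otimes> b \<otimes> a) # a # ys) @ c # d # ws)"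
    using hurwitz_letter_Gen[OF j, of G "a \<otimes> b \<otimes> a" a c d ws] by simp
  also have "\<dots> = hurwitz_word G [Gen j, Gen i] ts"
    using hurwitz_letter_Gen[OF zs(2), of G a b "ys @ c # d # ws"] by (simp add: hurwitz_word_def ts zs)
  finally show ?case .
next
  case (braid i)
  then obtain xs a b ys' where ts': "ts = xs @ a # b # ys'" "length xs = i"
    using split_at_adjacent[of i ts] tuples by (metis Suc_lessD)
  moreover have "ys' \<noteq> []"
    using braid(1) conjunct1[OF tuples[OF braid(2)]] ts' by auto
  then obtain c ys where "ys' = c # ys"
    by (cases ys') auto
  ultimately have ts: "ts = xs @ a # b # c # ys" "length xs = i"
    by auto
  have abc: "a \<in> carrier G" "b \<in> carrier G" "c \<in> carrier G" "a \<otimes> a = \<one>" "b \<otimes> b = \<one>"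
    using tuples[OF braid(2)] involutions[OF braid(2)] by (auto simp: ts)
  have first: "hurwitz_letter G (Gen i) (xs @ p # q # r # ys) = xs @ (p \<otimes> q \<otimes> p) # p # r # ys"
    for p q r
    using hurwitz_letter_Gen[OF ts(2)] .
  have second: "hurwitz_letter G (Gen (Suc i)) (xs @ p # q # r # ys) = xs @ p # (q \<otimes> r \<otimes> q) # q # ys"
    for p q r
    using hurwitz_letter_Gen[of "xs @ [p]" "Suc i" G q r ys] ts(2) by simp
  show ?case
    using abc by (simp add: hurwitz_word_def ts(1) first second m_assoc cancel_involution
        del: hurwitz_letter.simps)
qed auto

lemma hurwitz_action_class:
  assumes "u \<in> braid_words m"
  shows "hurwitz_action G E (braid_class m u) = (\<lambda>ts\<in>E. hurwitz_word G u ts)"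
proof -
  have "u \<in> braid_class m u"
    using assms by (simp add: braid_rel_def braid_equiv.refl)
  then have "(SOME v. v \<in> braid_class m u) \<in> braid_class m u"
    by (rule someI)
  then have "braid_equiv m u (SOME v. v \<in> braid_class m u)"
    by (simp add: braid_rel_def)
  then show ?thesis
    unfolding hurwitz_action_def
    by (intro restrict_ext) (simp add: hurwitz_word_cong)
qed

lemma hurwitz_word_inverse:
  assumes "u \<in> braid_words m" "ts \<in> E"
  shows "hurwitz_word G (inverse_word u) (hurwitz_word G u ts) = ts"
  using hurwitz_word_cong[OF inverse_word_left[OF assms(1)] assms(2)]
  by (simp add: hurwitz_word_append) (simp add: hurwitz_word_def)

lemma hurwitz_word_Bij:
  assumes "u \<in> braid_words m"
  shows "(\<lambda>ts\<in>E. hurwitz_word G u ts) \<in> Bij E"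
proof -
  have "bij_betw (hurwitz_word G u) E E"
    using assms hurwitz_word_stable inverse_word_in_braid_words[OF assms]
      hurwitz_word_inverse[OF assms] hurwitz_word_inverse[of "inverse_word u"]
    by (intro bij_betw_byWitness[of _ "hurwitz_word G (inverse_word u)"]) auto
  then show ?thesis
    by (simp add: Bij_def)
qed

lemma group_action_hurwitz: "group_action (braid_group m) E (hurwitz_action G E)"
proof -
  have "hurwitz_action G E \<in> hom (braid_group m) (BijGroup E)"
  proof (rule homI)
    fix X assume "X \<in> carrier (braid_group m)"
    then obtain u where u: "u \<in> braid_words m" "X = braid_class m u"
      by (auto simp: carrier_braid_group)
    show "hurwitz_action G E X \<in> carrier (BijGroup E)"
      using u hurwitz_word_Bij by (simp add: BijGroup_def hurwitz_action_class)
    fix Y assume "Y \<in> carrier (braid_group m)"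
    then obtain v where v: "v \<in> braid_words m" "Y = braid_class m v"
      by (auto simp: carrier_braid_group)
    have "(\<lambda>ts\<in>E. hurwitz_word G (u @ v) ts)
        = compose E (\<lambda>ts\<in>E. hurwitz_word G u ts) (\<lambda>ts\<in>E. hurwitz_word G v ts)"
      using hurwitz_word_stable[OF v(1)]
      by (auto simp: compose_def fun_eq_iff hurwitz_word_append)
    then show "hurwitz_action G E (X \<otimes>\<^bsub>braid_group m\<^esub> Y)
        = hurwitz_action G E X \<otimes>\<^bsub>BijGroup E\<^esub> hurwitz_action G E Y"
      using u v hurwitz_word_Bij
      by (simp add: mult_braid_group hurwitz_action_class braid_words_append BijGroup_def)
  qed
  then show ?thesis
    using group_braid_group group_BijGroup
    by (intro group_action.intro) (simp add: group_hom_def group_hom_axioms_def)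
qed

lemma transitive_action_hurwitz:
  assumes "\<And>ss ts. ss \<in> E \<Longrightarrow> ts \<in> E \<Longrightarrow> \<exists>u\<in>braid_words m. hurwitz_word G u ss = ts"
  shows "transitive_action (braid_group m) E (hurwitz_action G E)"
proof (rule transitive_action.intro[OF group_action_hurwitz], unfold_locales)
  fix ss ts assume E: "ss \<in> E" "ts \<in> E"
  then obtain u where u: "u \<in> braid_words m" "hurwitz_word G u ss = ts"
    using assms by blast
  then show "\<exists>g\<in>carrier (braid_group m). hurwitz_action G E g ss = ts"
    using E by (intro bexI[of _ "braid_class m u"])
      (simp_all add: hurwitz_action_class carrier_braid_group)
qed

end


section \<open>Weyl groups\<close>

lemma refl_prod_Bij: "refl_prod as \<in> Bij UNIV"
  by (simp add: Bij_def) (rule bij_betw_byWitness[of _ "refl_prod (rev as)"], auto)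

lemma mult_weyl_group:
  "refl_prod as \<otimes>\<^bsub>weyl_group X\<^esub> refl_prod bs = refl_prod (as @ bs)"
  using refl_prod_Bij[of as] refl_prod_Bij[of bs]
  by (simp add: weyl_group_def BijGroup_def compose_def fun_eq_iff)

lemma one_weyl_group: "\<one>\<^bsub>weyl_group X\<^esub> = refl_prod []"
  by (simp add: weyl_group_def BijGroup_def fun_eq_iff)

lemma reflection_eq_refl_prod: "reflection a = refl_prod [a]"
  by (simp add: fun_eq_iff)

lemma inv_BijGroup_refl_prod:
  fixes as :: "'a::euclidean_space list"
  shows "inv\<^bsub>BijGroup UNIV\<^esub> (refl_prod as) = refl_prod (rev as)"
proof (rule group.inv_equality[OF group_BijGroup])
  show "refl_prod (rev as) \<otimes>\<^bsub>BijGroup UNIV\<^esub> refl_prod as = \<one>\<^bsub>BijGroup UNIV\<^esub>"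
    using mult_weyl_group[of _ "rev as" as] one_weyl_group[where ?'a = 'a]
    by (simp add: weyl_group_def fun_eq_iff)
qed (use refl_prod_Bij in \<open>auto simp: BijGroup_def\<close>)

text \<open>Since reflections are involutions, inverses add nothing to the products.  Besides the Weyl
  group itself, this form covers its parabolic subgroups (\<open>X\<close> a set of transported simple roots)
  and the groups generated by the entries of a factorization.\<close>

lemma carrier_weyl_group: "carrier (weyl_group X) = {refl_prod as |as. set as \<subseteq> X}"
proof (intro equalityI subsetI)
  let ?B = "BijGroup UNIV :: ('a \<Rightarrow> 'a) monoid"
  fix g assume "g \<in> carrier (weyl_group X)"
  then have "g \<in> generate ?B (reflection ` X)"
    by (simp add: weyl_group_def)
  then have "\<exists>as. g = refl_prod as \<and> set as \<subseteq> X"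
  proof induction
    case one
    then show ?case
      using one_weyl_group[of X] by (intro exI[of _ "[]"]) (simp add: weyl_group_def)
  next
    case (incl h)
    then obtain a where "a \<in> X" "h = reflection a"
      by auto
    then show ?case
      by (intro exI[of _ "[a]"]) simp
  next
    case (inv h)
    then obtain a where "a \<in> X" "h = reflection a"
      by auto
    then show ?case
      using inv_BijGroup_refl_prod[of "[a]"] by (intro exI[of _ "[a]"]) simp
  next
    case (eng g h)
    then obtain as bs where "g = refl_prod as" "set as \<subseteq> X" "h = refl_prod bs" "set bs \<subseteq> X"
      by auto
    then show ?case
      using mult_weyl_group[of X as bs]
      by (intro exI[of _ "as @ bs"]) (simp add: weyl_group_def)
  qed
  then show "g \<in> {refl_prod as |as. set as \<subseteq> X}"
    by blast
next
  let ?B = "BijGroup UNIV :: ('a \<Rightarrow> 'a) monoid"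
  have gen: "refl_prod as \<in> generate ?B (reflection ` X)" if "set as \<subseteq> X" for as
    using that
  proof (induction as)
    case Nil
    then show ?case
      using one_weyl_group[of X] generate.one[of ?B "reflection ` X"]
      by (simp add: weyl_group_def id_def)
  next
    case (Cons a as)
    have "reflection a \<otimes>\<^bsub>?B\<^esub> refl_prod as \<in> generate ?B (reflection ` X)"
      using Cons by (intro generate.eng) (auto intro: generate.incl)
    then show ?case
      using mult_weyl_group[of X "[a]" as] by (simp add: weyl_group_def comp_def)
  qed
  fix g assume "g \<in> {refl_prod as |as. set as \<subseteq> X}"
  then show "g \<in> carrier (weyl_group X)"
    using gen by (auto simp: weyl_group_def)
qed

lemma subgroup_weyl_group: "subgroup (carrier (weyl_group X)) (BijGroup UNIV)"
proof -
  have "reflection ` X \<subseteq> carrier (BijGroup UNIV)"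
    using refl_prod_Bij[of "[a]" for a] by (auto simp: BijGroup_def)
  then show ?thesis
    using group.generate_is_subgroup[OF group_BijGroup] by (simp add: weyl_group_def)
qed

lemma reflection_in_weyl_group: "a \<in> X \<Longrightarrow> reflection a \<in> carrier (weyl_group X)"
  by (simp add: weyl_group_def generate.incl)

lemma weyl_group_eq: "weyl_group X = (BijGroup UNIV)\<lparr>carrier := carrier (weyl_group X)\<rparr>"
  by (simp add: weyl_group_def)

lemma group_weyl_group: "group (weyl_group X)"
  using group.subgroup_imp_group[OF group_BijGroup subgroup_weyl_group[of X]] weyl_group_eq[of X]
  by simp

lemma inv_weyl_group:
  assumes "set as \<subseteq> X"
  shows "inv\<^bsub>weyl_group X\<^esub> (refl_prod as) = refl_prod (rev as)"
proof -
  have "refl_prod as \<in> carrier (weyl_group X)"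
    using assms by (auto simp: carrier_weyl_group)
  then show ?thesis
    using group.m_inv_consistent[OF group_BijGroup subgroup_weyl_group]
    by (metis weyl_group_eq inv_BijGroup_refl_prod)
qed

lemma generate_weyl_group:
  assumes "reflection ` Y \<subseteq> carrier (weyl_group X)"
  shows "generate (weyl_group X) (reflection ` Y) = carrier (weyl_group Y)"
proof -
  have "generate (weyl_group X) (reflection ` Y) = generate (BijGroup UNIV) (reflection ` Y)"
    using group.generate_consistent[OF group_BijGroup assms subgroup_weyl_group] weyl_group_eq
    by metis
  then show ?thesis
    by (simp add: weyl_group_def)
qed

lemma refl_prod_map_refl_prod:
  "refl_prod (map (refl_prod us) bs) = refl_prod (us @ bs @ rev us)"
proof
  fix x
  show "refl_prod (map (refl_prod us) bs) x = refl_prod (us @ bs @ rev us) x"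
  proof (induction bs)
    case (Cons b bs)
    then show ?case
      using reflection_image[OF linear_refl_prod inner_refl_prod, of us b]
      by simp
  qed simp
qed

lemma conj_refl_prod:
  assumes "set us \<subseteq> X"
  shows "refl_prod us \<otimes>\<^bsub>weyl_group X\<^esub> refl_prod bs \<otimes>\<^bsub>weyl_group X\<^esub> inv\<^bsub>weyl_group X\<^esub> (refl_prod us)
    = refl_prod (map (refl_prod us) bs)"
  using inv_weyl_group[OF assms]
  by (simp add: mult_weyl_group refl_prod_map_refl_prod del: foldr_append)

lemma conj_reflection:
  assumes "set us \<subseteq> X"
  shows "refl_prod us \<otimes>\<^bsub>weyl_group X\<^esub> reflection b \<otimes>\<^bsub>weyl_group X\<^esub> inv\<^bsub>weyl_group X\<^esub> (refl_prod us)
    = reflection (refl_prod us b)"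
  using conj_refl_prod[OF assms, of "[b]"] by (simp add: reflection_eq_refl_prod del: foldr.simps)

lemma word_prod_reflections: "word_prod (weyl_group X) (map reflection as) = refl_prod as"
proof (induction as)
  case Nil
  then show ?case
    by (simp add: word_prod_def one_weyl_group)
next
  case (Cons a as)
  have "word_prod (weyl_group X) (map reflection (a # as))
      = refl_prod [a] \<otimes>\<^bsub>weyl_group X\<^esub> refl_prod as"
    using Cons by (simp add: word_prod_def)
  then show ?case
    by (simp only: mult_weyl_group append.simps)
qed

lemma map_reflection_of_subset:
  assumes "set ts \<subseteq> reflection ` X"
  obtains as where "ts = map reflection as" "set as \<subseteq> X"
proof -
  have "ts \<in> lists (reflection ` X)"
    using assms by auto
  then obtain as where "ts = map reflection as" "as \<in> lists X"
    unfolding lists_image by (rule imageE)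
  then show thesis
    using that[of as] by (simp add: lists_eq_set)
qed


section \<open>Root bases of parabolic quasi-Coxeter elements\<close>

context root_system
begin

text \<open>The parabolic subgroup is the group generated by the reflections in \<open>X\<close>, the transported
  subset of the simple roots.  Its rank bounds the number of factors, so that the roots of a
  generating factorization have no room to be linearly dependent.\<close>

lemma parabolic_quasi_coxeter_root_basis:
  assumes simple: "simple_system \<Phi> \<Delta>"
    and w: "parabolic_quasi_coxeter_element (weyl_group \<Phi>) (reflection ` \<Delta>) w"
  obtains as where "root_basis \<Phi> as" "refl_prod as = w"
proof -
  let ?W = "weyl_group \<Phi>"
  obtain v I where v: "v \<in> carrier ?W" and I: "I \<subseteq> reflection ` \<Delta>"
    and qc: "quasi_coxeter_element (?W\<lparr>carrier := conj_set ?W v (generate ?W I)\<rparr>) (conj_set ?W v I) w"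
    using w unfolding parabolic_quasi_coxeter_element_def by auto
  obtain us where us: "v = refl_prod us" "set us \<subseteq> \<Phi>"
    using v by (auto simp: carrier_weyl_group)
  obtain J where J: "J \<subseteq> \<Delta>" "I = reflection ` J"
    using I by (meson subset_imageE)
  have \<Delta>: "\<Delta> \<subseteq> \<Phi>"
    using simple by (simp add: simple_system_def)
  then have finJ: "finite J"
    using finite_subset[OF J(1) finite_subset[OF _ finite_roots]] by simp
  define X where "X = v ` J"
  have X: "X \<subseteq> \<Phi>"
    using J(1) \<Delta> refl_prod_root[OF us(2)] by (auto simp: X_def us(1))
  have simple_conj: "conj_set ?W v I = reflection ` X"
    by (simp add: conj_set_def us(1) J(2) X_def image_image conj_reflection[OF us(2)])
  have "reflection ` J \<subseteq> carrier ?W"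
    using J(1) \<Delta> by (auto intro: reflection_in_weyl_group)
  then have "generate ?W I = refl_prod ` lists J"
    using generate_weyl_group[of J] by (simp add: J(2) carrier_weyl_group setcompr_eq_image lists_eq_set)
  then have "conj_set ?W v (generate ?W I) = refl_prod ` map v ` lists J"
    by (simp add: conj_set_def us(1) conj_refl_prod[OF us(2)] image_image)
  also have "\<dots> = carrier (weyl_group X)"
    by (simp add: carrier_weyl_group setcompr_eq_image X_def flip: lists_eq_set lists_image)
  finally have "?W\<lparr>carrier := conj_set ?W v (generate ?W I)\<rparr> = weyl_group X"
    by (simp add: weyl_group_def)
  then have qc: "quasi_coxeter_element (weyl_group X) (reflection ` X) w"
    using qc simple_conj by simp
  then obtain ts where ts: "set ts \<subseteq> coxeter_reflections (weyl_group X) (reflection ` X)"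
      "word_prod (weyl_group X) ts = w" "length ts = card (reflection ` X)"
      "generate (weyl_group X) (set ts) = carrier (weyl_group X)"
    by (auto simp: quasi_coxeter_element_def Red_def)
  have "coxeter_reflections (weyl_group X) (reflection ` X)
      \<subseteq> reflection ` {\<beta> \<in> \<Phi>. reflection \<beta> \<in> carrier (weyl_group X)}"
  proof
    fix t assume "t \<in> coxeter_reflections (weyl_group X) (reflection ` X)"
    then obtain bs x where bs: "set bs \<subseteq> X" "x \<in> X"
        and "t = refl_prod bs \<otimes>\<^bsub>weyl_group X\<^esub> reflection x
          \<otimes>\<^bsub>weyl_group X\<^esub> inv\<^bsub>weyl_group X\<^esub> (refl_prod bs)"
      by (auto simp: coxeter_reflections_def conj_set_def carrier_weyl_group)
    then have t: "t = reflection (refl_prod bs x)"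
      by (simp add: conj_reflection)
    have "t = refl_prod (bs @ [x] @ rev bs)"
      using refl_prod_map_refl_prod[of bs "[x]"] t by simp
    then have "t \<in> carrier (weyl_group X)"
      using bs(1,2) unfolding carrier_weyl_group
      by (intro CollectI exI[of _ "bs @ [x] @ rev bs"]) simp
    moreover have "refl_prod bs x \<in> \<Phi>"
      using bs X by (intro refl_prod_root) auto
    ultimately show "t \<in> reflection ` {\<beta> \<in> \<Phi>. reflection \<beta> \<in> carrier (weyl_group X)}"
      using t by auto
  qed
  then obtain as where as: "ts = map reflection as"
      "set as \<subseteq> {\<beta> \<in> \<Phi>. reflection \<beta> \<in> carrier (weyl_group X)}"
    by (rule map_reflection_of_subset[OF subset_trans[OF ts(1)]])
  have carrier_eq: "carrier (weyl_group X) = carrier (weyl_group (set as))"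
    using generate_weyl_group[of "set as" X] as ts(4) by auto
  have "root_basis \<Phi> as"
  proof (rule root_basis_of_parabolic_generators[OF simple J(1) us(2)])
    show "set as \<subseteq> \<Phi>"
      using as(2) by auto
    have "card (reflection ` X) \<le> card X"
      using finJ by (intro card_image_le) (simp add: X_def)
    also have "\<dots> \<le> card J"
      using finJ by (simp add: X_def card_image_le)
    finally show "length as \<le> card J"
      using ts(3) as(1) by simp
    fix \<delta> assume "\<delta> \<in> J"
    then have "reflection (refl_prod us \<delta>) \<in> carrier (weyl_group (set as))"
      unfolding carrier_eq[symmetric] by (intro reflection_in_weyl_group) (simp add: X_def us(1))
    then obtain bs where "reflection (refl_prod us \<delta>) = refl_prod bs" "set bs \<subseteq> set as"
      unfolding carrier_weyl_group by (elim CollectE exE conjE)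
    then show "\<exists>bs. set bs \<subseteq> set as \<and> reflection (refl_prod us \<delta>) = refl_prod bs"
      by (intro exI[of _ bs] conjI)
  qed
  moreover have "refl_prod as = w"
    using ts(2) as(1) by (simp add: word_prod_reflections)
  ultimately show thesis
    by (rule that)
qed


section \<open>Reduced factorizations\<close>

text \<open>Any factorization of \<open>w\<close> needs at least as many reflections as the dimension of the image of
  \<open>1 - w\<close>; hence linearly independent roots give a reduced factorization.\<close>

lemma length_le_of_refl_prod_eq:
  fixes as bs :: "'a list"
  assumes "dim (set as) = length as" "refl_prod as = refl_prod bs"
  shows "length as \<le> length bs"
proof (rule ccontr)
  assume "\<not> ?thesis"
  then have less: "length bs < length as"
    by simp
  then have "dim (set bs) = dim (set as)"
    using span_eq_of_refl_prod_eq[OF assms(1) _ assms(2)] by (metis dim_span less_imp_le)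
  then show False
    using dim_le_card'[of "set bs"] card_length[of bs] assms(1) less by simp
qed

lemma reflection_length_root_basis:
  assumes "root_basis \<Phi> as"
  shows "reflection_length (weyl_group \<Phi>) (reflection ` \<Phi>) (refl_prod as) = length as"
  unfolding reflection_length_def
proof (rule Least_equality)
  show "\<exists>ts. set ts \<subseteq> reflection ` \<Phi> \<and> length ts = length as \<and>
      word_prod (weyl_group \<Phi>) ts = refl_prod as"
    using assms by (intro exI[of _ "map reflection as"])
      (auto simp: root_basis_def word_prod_reflections)
  fix n assume "\<exists>ts. set ts \<subseteq> reflection ` \<Phi> \<and> length ts = n \<and>
      word_prod (weyl_group \<Phi>) ts = refl_prod as"
  then obtain ts where ts: "set ts \<subseteq> reflection ` \<Phi>" "length ts = n"
      "word_prod (weyl_group \<Phi>) ts = refl_prod as"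
    by auto
  obtain bs where bs: "ts = map reflection bs" "set bs \<subseteq> \<Phi>"
    using map_reflection_of_subset[OF ts(1)] .
  then have "length as \<le> length bs"
    using assms ts(3)
    by (intro length_le_of_refl_prod_eq) (auto simp: root_basis_def word_prod_reflections)
  then show "length as \<le> n"
    using bs(1) ts(2) by simp
qed

lemma Red_root_basis:
  assumes "root_basis \<Phi> as"
  shows "Red (weyl_group \<Phi>) (reflection ` \<Phi>) (refl_prod as)
    = {map reflection bs |bs. set bs \<subseteq> \<Phi> \<and> length bs = length as \<and> refl_prod bs = refl_prod as}"
proof (intro equalityI subsetI)
  fix ts assume "ts \<in> Red (weyl_group \<Phi>) (reflection ` \<Phi>) (refl_prod as)"
  then have ts: "set ts \<subseteq> reflection ` \<Phi>" "length ts = length as"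
      "word_prod (weyl_group \<Phi>) ts = refl_prod as"
    by (simp_all add: Red_def reflection_length_root_basis[OF assms])
  obtain bs where "ts = map reflection bs" "set bs \<subseteq> \<Phi>"
    using map_reflection_of_subset[OF ts(1)] .
  then show "ts \<in> {map reflection bs |bs.
      set bs \<subseteq> \<Phi> \<and> length bs = length as \<and> refl_prod bs = refl_prod as}"
    using ts by (intro CollectI exI[of _ bs]) (simp add: word_prod_reflections)
qed (auto simp: Red_def reflection_length_root_basis[OF assms] word_prod_reflections intro!: imageI)

end


section \<open>The Hurwitz action on reduced factorizations\<close>

lemma mult_reflections:
  "reflection a \<otimes>\<^bsub>weyl_group X\<^esub> reflection b \<otimes>\<^bsub>weyl_group X\<^esub> reflection a
    = reflection (reflection a b)"
proof -
  have "refl_prod [a] \<otimes>\<^bsub>weyl_group X\<^esub> refl_prod [b] \<otimes>\<^bsub>weyl_group X\<^esub> refl_prod [a]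
      = refl_prod [a, b, a]"
    by (simp only: mult_weyl_group append.simps)
  then show ?thesis
    by (simp add: fun_eq_iff reflection_reflection_image)
qed

lemma hurwitz_letter_reflections:
  "hurwitz_letter (weyl_group X) (Gen (length xs)) (map reflection (xs @ a # b # ys))
    = map reflection (xs @ reflection a b # a # ys)"
  "hurwitz_letter (weyl_group X) (Gen_inv (length xs)) (map reflection (xs @ a # b # ys))
    = map reflection (xs @ b # reflection b a # ys)"
  by (simp_all add: hurwitz_letter_Gen hurwitz_letter_Gen_inv mult_reflections
      del: hurwitz_letter.simps)

text \<open>Each Hurwitz move on roots is one braid generator or its inverse on reflections, and sign
  changes are invisible there.\<close>

lemma hurwitz_equiv_braid_word:
  assumes "hurwitz_equiv us vs"
  shows "\<exists>u\<in>braid_words (length us). hurwitz_word (weyl_group X) u (map reflection us) = map reflection vs"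
  using assms
proof induction
  case refl
  then show ?case
    by (intro bexI[of _ "[]"]) (auto simp: hurwitz_word_def braid_words_def)
next
  case (forward xs a b ys)
  then obtain u where u: "u \<in> braid_words (length us)"
      "hurwitz_word (weyl_group X) u (map reflection us) = map reflection (xs @ a # b # ys)"
    by auto
  have "Suc (length xs) < length us"
    using hurwitz_equiv_length[OF forward.hyps] by simp
  then show ?case
    using u hurwitz_letter_reflections(1)[of X xs a b ys]
    by (intro bexI[of _ "Gen (length xs) # u"])
      (simp_all add: hurwitz_word_def braid_words_Cons del: hurwitz_letter.simps)
next
  case (backward xs a b ys)
  then obtain u where u: "u \<in> braid_words (length us)"
      "hurwitz_word (weyl_group X) u (map reflection us) = map reflection (xs @ a # b # ys)"
    by auto
  have "Suc (length xs) < length us"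
    using hurwitz_equiv_length[OF backward.hyps] by simp
  then show ?case
    using u hurwitz_letter_reflections(2)[of X xs a b ys]
    by (intro bexI[of _ "Gen_inv (length xs) # u"])
      (simp_all add: hurwitz_word_def braid_words_Cons del: hurwitz_letter.simps)
next
  case (sign xs a ys)
  then show ?case
    by (simp add: reflection_uminus)
qed

lemma (in root_system) hurwitz_stable_Red:
  assumes "root_basis \<Phi> as"
  shows "hurwitz_stable (weyl_group \<Phi>) (length as)
    (Red (weyl_group \<Phi>) (reflection ` \<Phi>) (refl_prod as))"
proof (intro hurwitz_stable.intro hurwitz_stable_axioms.intro group_weyl_group)
  fix ts assume "ts \<in> Red (weyl_group \<Phi>) (reflection ` \<Phi>) (refl_prod as)"
  then obtain bs where bs: "ts = map reflection bs" "set bs \<subseteq> \<Phi>" "length bs = length as"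
      "refl_prod bs = refl_prod as"
    by (auto simp: Red_root_basis[OF assms])
  show "length ts = length as \<and> set ts \<subseteq> carrier (weyl_group \<Phi>)"
    using bs(1-3) by (auto intro: reflection_in_weyl_group)
  show "t \<otimes>\<^bsub>weyl_group \<Phi>\<^esub> t = \<one>\<^bsub>weyl_group \<Phi>\<^esub>" if "t \<in> set ts" for t
  proof -
    obtain b where t: "t = refl_prod [b]"
      using \<open>t \<in> set ts\<close> bs(1) by (auto simp flip: reflection_eq_refl_prod)
    show ?thesis
      unfolding t mult_weyl_group one_weyl_group by (simp add: fun_eq_iff)
  qed
  fix l assume l: "Suc (letter_index l) < length as"
  obtain xs a b ys where split: "bs = xs @ a # b # ys" "length xs = letter_index l"
    using split_at_adjacent[of "letter_index l" bs] l bs(3) by metis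
  define cs where "cs = (case l of Gen _ \<Rightarrow> xs @ reflection a b # a # ys
    | Gen_inv _ \<Rightarrow> xs @ b # reflection b a # ys)"
  have "hurwitz_equiv bs cs"
    unfolding cs_def split(1)
    by (auto split: braid_letter.split intro: hurwitz_equiv.intros)
  then have "length cs = length as" "refl_prod cs = refl_prod as"
    using hurwitz_equiv_length hurwitz_equiv_refl_prod bs(3,4) by metis+
  moreover have "set cs \<subseteq> \<Phi>"
    using bs(2) reflection_root by (auto simp: cs_def split(1) split: braid_letter.split)
  moreover have "hurwitz_letter (weyl_group \<Phi>) l ts = map reflection cs"
    using split(2) hurwitz_letter_reflections[of \<Phi> xs a b ys]
    by (cases l) (simp_all add: bs(1) split(1) cs_def del: hurwitz_letter.simps)
  ultimately show "hurwitz_letter (weyl_group \<Phi>) l ts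
      \<in> Red (weyl_group \<Phi>) (reflection ` \<Phi>) (refl_prod as)"
    by (auto simp: Red_root_basis[OF assms])
qed

theorem theorem1p4:
  fixes \<Phi> \<Delta> :: "'a::euclidean_space set" and w :: "'a \<Rightarrow> 'a"
  defines "W \<equiv> weyl_group \<Phi>"
    and "S \<equiv> reflection ` \<Delta>"
    and "T \<equiv> reflection ` \<Phi>"
  assumes "crystallographic_root_system \<Phi>"
    and "simple_system \<Phi> \<Delta>"
    and "w \<in> carrier W"
    and "parabolic_quasi_coxeter_element W S w"
  shows "transitive_action (braid_group (reflection_length W T w)) (Red W T w)
           (hurwitz_action W (Red W T w))"
proof -
  interpret root_system \<Phi>
    by standard (rule assms(4))
  obtain as where as: "root_basis \<Phi> as" "refl_prod as = w"
    using parabolic_quasi_coxeter_root_basis[OF assms(5)] assms(7) unfolding W_def S_def by metis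
  interpret hurwitz_stable W "length as" "Red W T w"
    using hurwitz_stable_Red[OF as(1)] by (simp add: W_def T_def as(2))
  have "\<exists>u\<in>braid_words (length as). hurwitz_word W u ss = ts"
    if "ss \<in> Red W T w" "ts \<in> Red W T w" for ss ts
  proof -
    have Red: "Red W T w = {map reflection bs |bs.
        set bs \<subseteq> \<Phi> \<and> length bs = length as \<and> refl_prod bs = refl_prod as}"
      using Red_root_basis[OF as(1)] by (simp only: W_def T_def as(2))
    obtain bs where ss: "ss = map reflection bs"
      and bs: "set bs \<subseteq> \<Phi>" "length bs = length as" "refl_prod bs = refl_prod as"
      using \<open>ss \<in> Red W T w\<close> unfolding Red by blast
    obtain cs where ts: "ts = map reflection cs"
      and cs: "set cs \<subseteq> \<Phi>" "length cs = length as" "refl_prod cs = refl_prod as"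
      using \<open>ts \<in> Red W T w\<close> unfolding Red by blast
    obtain bs' where bs': "hurwitz_equiv as bs'" "map reflection bs' = ss"
      using hurwitz_transitive_roots[OF as(1) bs] ss by auto
    have "root_basis \<Phi> bs'" "length cs = length bs'" "refl_prod cs = refl_prod bs'"
      using root_basis_hurwitz_equiv[OF bs'(1) as(1)] hurwitz_equiv_length[OF bs'(1)]
        hurwitz_equiv_refl_prod[OF bs'(1)] cs by auto
    then obtain cs' where cs': "hurwitz_equiv bs' cs'" "map reflection cs' = ts"
      using hurwitz_transitive_roots cs(1) ts by metis
    then show ?thesis
      using hurwitz_equiv_braid_word[OF cs'(1), of \<Phi>] bs'(2) hurwitz_equiv_length[OF bs'(1)]
      by (simp add: W_def)
  qed
  then have "transitive_action (braid_group (length as)) (Red W T w) (hurwitz_action W (Red W T w))"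
    by (rule transitive_action_hurwitz)
  then show ?thesis
    using reflection_length_root_basis[OF as(1)] by (simp add: W_def T_def as(2))
qed

end
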